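(* Given a compact subset $A$ of a Jordan domain $U$ and constants $r>0$ and $c,M\in\mathbb{N}_{\geq1}$, there exists a constant $R=R(U,A,r,c,M)>0$ such that for every orbifold $\mathcal{O}$ with underlying surface $U$ and at most $M$ ramified points, each with ramification value smaller than or equal to $c$, and such that the Euclidean distance between any two of them is at least $r$, it holds that $$d_{\mathcal{O}}(p,q)<R\quad\text{for every } p,q\in A.$$
   Context: A Jordan domain is a complementary component of a Jordan curve on the sphere that is also a simply connected domain in $\mathbb{C}$ (possibly unbounded). A Riemann orbifold is a pair $\mathcal{O}=(S,\nu)$ of a Riemann surface $S$ (the underlying surface) and a map $\nu\colon S\to\mathbb{N}_{\ge1}$ such that $\{z\in S:\nu(z)>1\}$ is discrete; points with $\nu(z)>1$ are ramified, with ramification value $\nu(z)$. A universal covering map of $\mathcal{O}$ by the unit disc is a holomorphic branched covering map $\pi\colon\mathbb{D}\to S$ (every $z\in S$ has a connected neighbourhood $V$ such that $\pi$ maps any component of $\pi^{-1}(V)$ onto $V$ as a proper map) with $\nu(\pi(x))=\deg(\pi,x)$ (local degree) for all $x\in\mathbb{D}$; it exists for every orbifold whose underlying surface is a Jordan domain $U\subsetneq\mathbb{C}$. The orbifold metric $\rho_{\mathcal{O}}(w)|dw|$ is the pushforward of the hyperbolic metric, determined by $\rho_{\mathbb{D}}(x)=|\pi'(x)|\,\rho_{\mathcal{O}}(\pi(x))$ with $\rho_{\mathbb{D}}(x)=2/(1-|x|^2)$; $d_{\mathcal{O}}(p,q)$ is the infimum of $\int_\gamma\rho_{\mathcal{O}}(w)|dw|$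 over rectifiable curves $\gamma\subset S$ joining $p$ and $q$. *)

theory Defs
  imports "HOL-Complex_Analysis.Complex_Analysis"
begin

text \<open>The sphere is the one-point compactification of the plane, with \<^term>\<open>None\<close> as the point
  at infinity.  Jordan curves are allowed to pass through infinity.\<close>

definition riemann_sphere :: "complex option topology" where
  "riemann_sphere = Alexandroff_compactification euclidean"

definition jordan_curve :: "complex option set \<Rightarrow> bool" where
  "jordan_curve C \<longleftrightarrow> C \<subseteq> topspace riemann_sphere \<and>
     subtopology riemann_sphere C homeomorphic_space top_of_set (sphere (0::complex) 1)"

definition jordan_domain :: "complex set \<Rightarrow> bool" where
  "jordan_domain U \<longleftrightarrow> open U \<and> simply_connected U \<and>
     (\<exists>C. jordan_curve C \<and>
        Some ` U \<in> connected_components_of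
                     (subtopology riemann_sphere (topspace riemann_sphere - C)))"

text \<open>Orbifolds whose underlying surface is a plane domain \<open>S\<close>.  Only the values of \<open>\<nu>\<close> on \<open>S\<close>
  matter.\<close>

definition ramified_points :: "complex set \<Rightarrow> (complex \<Rightarrow> nat) \<Rightarrow> complex set" where
  "ramified_points S \<nu> = {z \<in> S. \<nu> z > 1}"

definition planar_orbifold :: "complex set \<Rightarrow> (complex \<Rightarrow> nat) \<Rightarrow> bool" where
  "planar_orbifold S \<nu> \<longleftrightarrow> open S \<and> connected S \<and> S \<noteq> {} \<and>
     (\<forall>z\<in>S. \<nu> z \<ge> 1) \<and> discrete (ramified_points S \<nu>)"

definition branched_covering_of_disc :: "complex set \<Rightarrow> (complex \<Rightarrow> complex) \<Rightarrow> bool" where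
  "branched_covering_of_disc S \<pi> \<longleftrightarrow>
     \<pi> holomorphic_on ball 0 1 \<and> \<pi> ` ball 0 1 \<subseteq> S \<and>
     (\<forall>z\<in>S. \<exists>V. open V \<and> connected V \<and> z \<in> V \<and> V \<subseteq> S \<and>
        (\<forall>W\<in>components (ball 0 1 \<inter> \<pi> -` V).
            \<pi> ` W = V \<and> proper_map (top_of_set W) (top_of_set V) \<pi>))"

definition local_degree :: "(complex \<Rightarrow> complex) \<Rightarrow> complex \<Rightarrow> int" where
  "local_degree f x = zorder (\<lambda>w. f w - f x) x"

definition orbifold_universal_covering ::
    "complex set \<Rightarrow> (complex \<Rightarrow> nat) \<Rightarrow> (complex \<Rightarrow> complex) \<Rightarrow> bool" where
  "orbifold_universal_covering S \<nu> \<pi> \<longleftrightarrow> branched_covering_of_disc S \<pi> \<and>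
     (\<forall>x\<in>ball 0 1. int (\<nu> (\<pi> x)) = local_degree \<pi> x)"

definition disc_density :: "complex \<Rightarrow> real" where
  "disc_density x = 2 / (1 - (cmod x)\<^sup>2)"

text \<open>The density of the orbifold metric, obtained by solving
  \<open>disc_density x = cmod (deriv \<pi> x) * orbifold_density \<pi> (\<pi> x)\<close>.  Two points of a fibre of a
  universal covering differ by a disc automorphism \<open>\<sigma>\<close> with \<open>\<pi> \<circ> \<sigma> = \<pi>\<close>, so the quotient does not
  depend on the point of the fibre that \<^const>\<open>inv_into\<close> selects.  At ramified points \<open>\<pi>\<close> has a
  critical point and the quotient is \<open>\<infinity>\<close>.\<close>

definition orbifold_density :: "(complex \<Rightarrow> complex) \<Rightarrow> complex \<Rightarrow> ennreal" where
  "orbifold_density \<pi> w =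
     (let x = inv_into (ball 0 1) \<pi> w
      in ennreal (disc_density x) / ennreal (cmod (deriv \<pi> x)))"

text \<open>Lengths of the polygons inscribed in \<open>\<gamma>\<close> restricted to the interval from \<open>0\<close> to \<open>t\<close>; the sequence
  \<open>s\<close> lists the subdivision points (only \<open>s 0, \<dots>, s n\<close> are used).\<close>

definition polygon_lengths :: "(real \<Rightarrow> complex) \<Rightarrow> real \<Rightarrow> real set" where
  "polygon_lengths \<gamma> t =
     {(\<Sum>i<n. dist (\<gamma> (s i)) (\<gamma> (s (Suc i)))) | (n::nat) (s::nat \<Rightarrow> real).
        mono s \<and> range s \<subseteq> {0..t}}"

definition rectifiable :: "(real \<Rightarrow> complex) \<Rightarrow> bool" where
  "rectifiable \<gamma> \<longleftrightarrow> path \<gamma> \<and> bdd_above (polygon_lengths \<gamma> 1)"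

text \<open>The arc length of \<open>\<gamma>\<close> up to parameter \<open>t\<close>, extended to be constant outside the unit interval so
  that the associated Stieltjes measure is the arc length measure of \<open>\<gamma>\<close>.\<close>

definition arc_length :: "(real \<Rightarrow> complex) \<Rightarrow> real \<Rightarrow> real" where
  "arc_length \<gamma> t = Sup (polygon_lengths \<gamma> (max 0 (min 1 t)))"

definition length_integral :: "(complex \<Rightarrow> ennreal) \<Rightarrow> (real \<Rightarrow> complex) \<Rightarrow> ennreal" where
  "length_integral \<rho> \<gamma> = (\<integral>\<^sup>+t\<in>{0..1}. \<rho> (\<gamma> t) \<partial>interval_measure (arc_length \<gamma>))"

definition orbifold_dist ::
    "complex set \<Rightarrow> (complex \<Rightarrow> complex) \<Rightarrow> complex \<Rightarrow> complex \<Rightarrow> ennreal" where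
  "orbifold_dist S \<pi> p q =
     (INF \<gamma>\<in>{\<gamma>. rectifiable \<gamma> \<and> path_image \<gamma> \<subseteq> S \<and> pathstart \<gamma> = p \<and> pathfinish \<gamma> = q}.
        length_integral (orbifold_density \<pi>) \<gamma>)"

end

theory Submission
  imports Defs
begin

text \<open>Let \<open>z\<close> be a point of \<open>U\<close> with ramification value \<open>n\<close>, and let the disc of radius \<open>d\<close> about \<open>z\<close>
  lie in \<open>U\<close> and contain no other ramified point.  The map \<open>t \<mapsto> z + d t\<^sup>n\<close> of the unit disc lifts
  through \<open>\<pi>\<close>, so by the Schwarz--Pick lemma the orbifold density at \<open>z + d t\<^sup>n\<close> is at most the
  hyperbolic density at \<open>t\<close> divided by \<open>d n \<bar>t\<bar>\<^bsup>n-1\<^esup>\<close>.  With \<open>n \<le> c\<close> and the ramified points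
  \<open>r\<close>-separated, the density at \<open>w\<close> is therefore bounded by a constant plus a constant times
  the sum of \<open>\<bar>w - z\<bar>\<^bsup>1/c-1\<^esup>\<close> over the ramified points \<open>z\<close>, uniformly over the orbifolds considered as long as
  \<open>w\<close> stays away from the boundary.  This is integrable along segments, uniformly in the
  position of the ramified points, which bounds the distance of nearby points; connectedness of
  \<open>U\<close> and compactness of \<open>A\<close> do the rest.\<close>

section \<open>Hyperbolic contraction and covering maps\<close>

text \<open>The power map lifts because \<open>n\<close> is exactly the local degree of
  \<open>\<pi>\<close> over \<open>z\<close>: a small loop about \<open>0\<close> in the
  \<open>t\<close>-disc winds \<open>n\<close> times about \<open>z\<close>, and its lift closes up.
  The bound \<open>c\<close> enters through the exponent: since
  \<open>|t| = (|w - z| / d)^(1/n)\<close>, the factor \<open>|t|^(1-n)\<close> is a power of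
  \<open>|w - z|\<close> with exponent \<open>1/n - 1\<close>, and
  \<open>1/n - 1 \<ge> 1/c - 1 > -1\<close> makes it integrable along a line. Length is a Stieltjes
  integral against arc length; for a Lipschitz curve this measure is at most a multiple of Lebesgue
  measure, so upper bounds in the curve parameter suffice. Uniformity over the orbifolds survives
  the final gluing because each gluing step treats all of them at once with one constant.\<close>

lemma Moebius_function_has_derivative:
  assumes "norm w < 1" "norm z < 1"
  shows "(Moebius_function 0 w has_field_derivative
           of_real (1 - (norm w)\<^sup>2) / (1 - cnj w * z)\<^sup>2) (at z)"
proof -
  have ne: "1 - cnj w * z \<noteq> 0"
  proof
    assume "1 - cnj w * z = 0"
    then have "norm (cnj w * z) = 1" by simp
    then show False
      using assms norm_mult_less[of "cnj w" 1 z 1] by simp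
  qed
  have "((\<lambda>z. (z - w) / (1 - cnj w * z)) has_field_derivative
           of_real (1 - (norm w)\<^sup>2) / (1 - cnj w * z)\<^sup>2) (at z)"
    using ne
    unfolding of_real_diff complex_norm_square
    by (auto intro!: derivative_eq_intros simp: power2_eq_square mult.commute)
       (simp add: field_simps)
  then show ?thesis
    by (simp add: Moebius_function_simple[abs_def])
qed

text \<open>Disc automorphisms taking \<open>0\<close> to \<open>t\<close> and \<open>f t\<close> to
  \<open>0\<close> turn \<open>f\<close> into a self-map \<open>g\<close> of the disc fixing
  \<open>0\<close>. The Schwarz lemma bounds \<open>deriv g 0\<close> by \<open>1\<close>, and the
  chain rule translates this back.\<close>

lemma Schwarz_Pick_deriv:
  assumes holf: "f holomorphic_on ball 0 1"
      and f1: "\<And>z. norm z < 1 \<Longrightarrow> norm (f z) < 1" and t: "norm t < 1"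
  shows "disc_density (f t) * norm (deriv f t) \<le> disc_density t"
proof -
  define g where "g = Moebius_function 0 (f t) \<circ> (f \<circ> Moebius_function 0 (-t))"
  have M: "Moebius_function 0 (-t) holomorphic_on ball 0 1"
    "Moebius_function 0 (f t) holomorphic_on ball 0 1"
    using t f1[OF t] by (simp_all add: Moebius_function_holomorphic)
  have im1: "Moebius_function 0 (-t) ` ball 0 1 \<subseteq> ball 0 1"
    using Moebius_function_norm_lt_1[of "-t"] t by (simp add: image_subset_iff)
  have im2: "f ` ball 0 1 \<subseteq> ball 0 1"
    using f1 by (simp add: image_subset_iff)
  have holfM: "f \<circ> Moebius_function 0 (-t) holomorphic_on ball 0 1"
    by (rule holomorphic_on_compose_gen[OF M(1) holf im1])
  have "(f \<circ> Moebius_function 0 (-t)) ` ball 0 1 \<subseteq> ball 0 1"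
    unfolding image_comp[symmetric] using im1 im2 by blast
  then have holg: "g holomorphic_on ball 0 1"
    unfolding g_def by (rule holomorphic_on_compose_gen[OF holfM M(2)])
  have t0: "Moebius_function 0 (-t) 0 = t"
    by (simp add: Moebius_function_of_zero)
  have g0: "g 0 = 0"
    by (simp add: g_def t0 Moebius_function_eq_zero)
  have g1: "norm (g z) < 1" if "norm z < 1" for z
    unfolding g_def o_def
    by (intro Moebius_function_norm_lt_1 f1) (use that t in simp_all)
  have "norm (deriv g 0) \<le> 1"
    using Schwarz_Lemma(2)[OF holg g0 g1, of 0] by auto
  have df: "(f has_field_derivative deriv f t) (at t)"
    using holomorphic_derivI[OF holf] t by auto
  have d1: "(Moebius_function 0 (-t) has_field_derivative of_real (1 - (norm t)\<^sup>2)) (at 0)"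
    using Moebius_function_has_derivative[of "-t" 0] t by simp
  have nz: "1 - (norm (f t))\<^sup>2 > 0" "1 - (norm t)\<^sup>2 > 0"
    using f1[OF t] t by (auto simp: power_less_one_iff abs_square_less_1)
  have "1 - cnj (f t) * f t = of_real (1 - (norm (f t))\<^sup>2)"
    by (simp only: of_real_diff complex_norm_square of_real_1 mult.commute)
  then have d2: "(Moebius_function 0 (f t) has_field_derivative 1 / of_real (1 - (norm (f t))\<^sup>2)) (at (f t))"
    using Moebius_function_has_derivative[of "f t" "f t"] f1[OF t] nz(1)
    by (simp add: power2_eq_square del: of_real_diff)
  have "(f has_field_derivative deriv f t) (at (Moebius_function 0 (-t) 0))"
    using df by (simp only: t0)
  from DERIV_chain[OF this d1] have d3: "(f \<circ> Moebius_function 0 (-t) has_field_derivative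
      deriv f t * of_real (1 - (norm t)\<^sup>2)) (at 0)" .
  have "(Moebius_function 0 (f t) has_field_derivative 1 / of_real (1 - (norm (f t))\<^sup>2))
      (at ((f \<circ> Moebius_function 0 (-t)) 0))"
    using d2 by (simp only: t0 o_def)
  from DERIV_chain[OF this d3] have "(g has_field_derivative
      1 / of_real (1 - (norm (f t))\<^sup>2) * (deriv f t * of_real (1 - (norm t)\<^sup>2))) (at 0)"
    unfolding g_def .
  then have "deriv g 0 = 1 / of_real (1 - (norm (f t))\<^sup>2) * (deriv f t * of_real (1 - (norm t)\<^sup>2))"
    by (rule DERIV_imp_deriv)
  then have "norm (deriv g 0) = norm (deriv f t) * (1 - (norm t)\<^sup>2) / (1 - (norm (f t))\<^sup>2)"
    using nz by (simp add: norm_mult norm_divide del: of_real_diff)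
  with \<open>norm (deriv g 0) \<le> 1\<close> nz
  show ?thesis
    by (simp add: disc_density_def field_simps)
qed

section \<open>Criteria for covering spaces\<close>

text \<open>The coincidence set is closed by continuity. It is open because near a coincidence both
  sections take values in a set where \<open>f\<close> is injective, and \<open>f\<close> sends both
  values to \<open>t\<close>.\<close>

lemma section_unique:
  fixes f :: "'a::metric_space \<Rightarrow> 'b::topological_space"
  assumes T: "connected T" and s: "continuous_on T \<sigma>" "continuous_on T \<tau>"
    and inv: "\<And>t. t \<in> T \<Longrightarrow> f (\<sigma> t) = t" "\<And>t. t \<in> T \<Longrightarrow> f (\<tau> t) = t"
    and inj: "\<And>t. t \<in> T \<Longrightarrow> \<exists>N. open N \<and> \<sigma> t \<in> N \<and> inj_on f N"
    and a: "a \<in> T" "\<sigma> a = \<tau> a" and t: "t \<in> T"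
  shows "\<sigma> t = \<tau> t"
proof -
  define E where "E = {t \<in> T. dist (\<sigma> t) (\<tau> t) = 0}"
  have "closedin (top_of_set T) E"
    unfolding E_def by (intro continuous_closedin_preimage_constant continuous_intros s)
  moreover have "openin (top_of_set T) E"
  proof (subst openin_subopen, safe)
    fix u assume "u \<in> E"
    then have u: "u \<in> T" "\<sigma> u = \<tau> u" by (auto simp: E_def)
    obtain N where N: "open N" "\<sigma> u \<in> N" "inj_on f N" using inj[OF u(1)] by blast
    have "openin (top_of_set T) ((T \<inter> \<sigma> -` N) \<inter> (T \<inter> \<tau> -` N))"
      using s N(1) by (intro openin_Int continuous_openin_preimage_gen)
    moreover have "u \<in> (T \<inter> \<sigma> -` N) \<inter> (T \<inter> \<tau> -` N)" using u N by auto
    moreover have "(T \<inter> \<sigma> -` N) \<inter> (T \<inter> \<tau> -` N) \<subseteq> E"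
    proof
      fix t assume "t \<in> (T \<inter> \<sigma> -` N) \<inter> (T \<inter> \<tau> -` N)"
      then have "\<sigma> t = \<tau> t" "t \<in> T" using inv N(3) by (auto intro: inj_onD)
      then show "t \<in> E" by (simp add: E_def)
    qed
    ultimately show "\<exists>X. openin (top_of_set T) X \<and> u \<in> X \<and> X \<subseteq> E" by blast
  qed
  ultimately have "E = {} \<or> E = T" using T by (simp add: connected_clopen)
  then show ?thesis using a t by (auto simp: E_def)
qed

lemma holomorphic_inj_homeomorphism:
  assumes "f holomorphic_on N" "open N" "inj_on f N" "B \<subseteq> f ` N"
  shows "\<exists>g. homeomorphism (N \<inter> f -` B) B f g"
proof -
  obtain g where g: "g holomorphic_on (f ` N)" "\<And>z. z \<in> N \<Longrightarrow> g (f z) = z"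
    using holomorphic_has_inverse[OF assms(1-3)] by metis
  have "continuous_on B g"
    using g(1) assms(4) holomorphic_on_imp_continuous_on continuous_on_subset by blast
  moreover have "continuous_on (N \<inter> f -` B) f"
    using assms(1) holomorphic_on_imp_continuous_on continuous_on_subset by blast
  moreover have "f ` (N \<inter> f -` B) \<subseteq> B" "g ` B \<subseteq> N \<inter> f -` B" "\<And>y. y \<in> B \<Longrightarrow> f (g y) = y"
    using g(2) assms(4) by force+
  ultimately have "homeomorphism (N \<inter> f -` B) B f g"
    using g(2) by (intro homeomorphismI) auto
  then show ?thesis by blast
qed

text \<open>A fibre is compact and, by local injectivity, has no limit points, so it is finite.
  Disjoint injectivity balls about its points give the sheets; properness excludes further preimages
  over a small enough disc.\<close>

lemma proper_local_homeo_covering_space: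
  assumes holf: "f holomorphic_on Y" and Y: "open Y" and T: "open T"
    and im: "f ` Y = T" and dnz: "\<And>x. x \<in> Y \<Longrightarrow> deriv f x \<noteq> 0"
    and pre: "\<And>K. K \<subseteq> T \<Longrightarrow> compact K \<Longrightarrow> compact (Y \<inter> f -` K)"
  shows "covering_space Y f T"
proof
  show contf: "continuous_on Y f" using holf holomorphic_on_imp_continuous_on by blast
  show "f ` Y = T" by fact
  fix y assume y: "y \<in> T"
  define F where "F = Y \<inter> f -` {y}"
  have cF: "compact F" unfolding F_def using pre[of "{y}"] y by auto
  have inj: "\<exists>r>0. ball x r \<subseteq> Y \<and> inj_on f (ball x r)" if x: "x \<in> Y" for x
  proof -
    obtain r where "r > 0" "ball x r \<subseteq> Y" "inj_on f (ball x r)"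
      using has_complex_derivative_locally_injective[OF holf x Y dnz[OF x]] .
    then show ?thesis by (intro exI[of _ r]) simp
  qed
  have "\<not> x islimpt F" if x: "x \<in> F" for x
  proof
    assume l: "x islimpt F"
    obtain r where r: "r>0" "inj_on f (ball x r)" using inj[of x] x by (auto simp: F_def)
    obtain x' where x': "x' \<in> F" "x' \<noteq> x" "dist x' x < r" using l r(1) unfolding islimpt_approachable by blast
    then have "x \<in> ball x r" "x' \<in> ball x r" "f x = f x'"
      using r(1) x by (simp_all add: F_def dist_commute)
    with inj_onD[OF r(2)] x'(2) show False by metis
  qed
  then have finF: "finite F"
    using cF by (meson compact_eq_Bolzano_Weierstrass subset_refl)
  obtain r where r: "\<And>x. x \<in> F \<Longrightarrow> r x > 0 \<and> ball x (r x) \<subseteq> Y \<and> inj_on f (ball x (r x))"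
  proof -
    have "\<forall>x\<in>F. \<exists>r>0. ball x r \<subseteq> Y \<and> inj_on f (ball x r)"
      using inj by (simp add: F_def)
    then show ?thesis using that by (metis (no_types, lifting))
  qed
  obtain d where d: "d > 0" "\<And>x x'. x \<in> F \<Longrightarrow> x' \<in> F \<Longrightarrow> x \<noteq> x' \<Longrightarrow> d \<le> dist x x'"
  proof -
    have "\<exists>d>0. \<forall>x\<in>F. \<forall>x'\<in>F. x \<noteq> x' \<longrightarrow> d \<le> dist x x'"
    proof (cases "F = {}")
      case False
      have "\<exists>e. \<forall>x\<in>F. e x > 0 \<and> (\<forall>x'\<in>F. x' \<noteq> x \<longrightarrow> e x \<le> dist x x')"
        using finite_set_avoid[OF finF] by (intro bchoice) blast
      then obtain e where e: "\<forall>x\<in>F. e x > 0 \<and> (\<forall>x'\<in>F. x' \<noteq> x \<longrightarrow> e x \<le> dist x x')" by blast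
      show ?thesis
        using False finF e
        by (intro exI[of _ "Min (e ` F)"]) (auto simp: Min_le_iff, metis)
    qed (auto intro: exI[of _ 1])
    then show ?thesis using that by blast
  qed
  define \<rho> where "\<rho> x = min (r x) (d/2)" for x
  define N where "N x = ball x (\<rho> x)" for x
  have N: "x \<in> N x" "open (N x)" "N x \<subseteq> Y" "inj_on f (N x)" if "x \<in> F" for x
    using r[OF that] d(1) by (auto simp: N_def \<rho>_def intro: inj_on_subset)
  have disj: "N x \<inter> N x' = {}" if "x \<in> F" "x' \<in> F" "x \<noteq> x'" for x x'
  proof (rule ccontr)
    assume "N x \<inter> N x' \<noteq> {}"
    then obtain u where "dist x u < d/2" "dist x' u < d/2" by (auto simp: N_def \<rho>_def)
    then show False using d(2)[OF that] by (metis dist_commute dist_triangle_half_r linorder_not_less)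
  qed
  obtain e0 where e0: "e0 > 0" "cball y e0 \<subseteq> T" using T y open_contains_cball by blast
  \<comment> \<open>\<open>C\<close> is the part of the preimage of a closed disc that lies outside
    the candidate sheets. Its image is compact and misses \<open>y\<close>, so over a smaller disc
    the whole preimage lies in the sheets.\<close>
  define C where "C = (Y \<inter> f -` cball y e0) - (\<Union>x\<in>F. N x)"
  have "compact C"
    unfolding C_def using pre[OF e0(2)] N(2) by (intro compact_diff) auto
  then have "compact (f ` C)"
    by (rule compact_continuous_image[rotated]) (use contf C_def in \<open>auto intro: continuous_on_subset\<close>)
  moreover have "y \<notin> f ` C" using N(1) by (auto simp: C_def F_def)
  ultimately have "open (- (f ` C))" "y \<in> - (f ` C)" using compact_imp_closed by auto
  moreover have opN: "open (f ` N x)" if "x \<in> F" for x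
    using N[OF that] holf by (intro open_mapping_thm3) (auto intro: holomorphic_on_subset)
  ultimately have "open (ball y e0 \<inter> - (f ` C) \<inter> (\<Inter>x\<in>F. f ` N x))"
    using finF by (intro open_Int open_INT) auto
  moreover have "y \<in> ball y e0 \<inter> - (f ` C) \<inter> (\<Inter>x\<in>F. f ` N x)"
    using e0 \<open>y \<in> - f ` C\<close> N(1) by (auto simp: F_def intro!: image_eqI)
  ultimately obtain e where e: "e > 0" "ball y e \<subseteq> ball y e0 \<inter> - (f ` C) \<inter> (\<Inter>x\<in>F. f ` N x)"
    using openE by blast
  define B where "B = ball y e"
  define v where "v = (\<lambda>x. N x \<inter> f -` B) ` F"
  have "B \<subseteq> T" using e(2) e0 ball_subset_cball unfolding B_def by blast
  show "\<exists>T'. y \<in> T' \<and> openin (top_of_set T) T' \<and>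
          (\<exists>v. \<Union> v = Y \<inter> f -` T' \<and> (\<forall>u\<in>v. openin (top_of_set Y) u) \<and> pairwise disjnt v \<and>
               (\<forall>u\<in>v. \<exists>q. homeomorphism u T' f q))"
  proof (intro exI[of _ B] exI[of _ v] conjI ballI)
    show "y \<in> B" using e by (simp add: B_def)
    show "openin (top_of_set T) B" using \<open>B \<subseteq> T\<close> by (simp add: B_def open_subset)
    show "\<Union> v = Y \<inter> f -` B"
    proof
      show "\<Union> v \<subseteq> Y \<inter> f -` B" using N(3) by (auto simp: v_def)
      show "Y \<inter> f -` B \<subseteq> \<Union> v"
      proof
        fix u assume u: "u \<in> Y \<inter> f -` B"
        then have "f u \<in> ball y e0 \<inter> - (f ` C)" using e(2) B_def by blast
        then have "u \<notin> C" "f u \<in> cball y e0" by auto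
        then have "u \<in> (\<Union>x\<in>F. N x)" using u by (auto simp: C_def)
        then show "u \<in> \<Union> v" using u by (auto simp: v_def)
      qed
    qed
    show "pairwise disjnt v"
      unfolding v_def pairwise_image pairwise_def disjnt_def using disj by blast
    show "openin (top_of_set Y) u" if u: "u \<in> v" for u
    proof -
      obtain x where x: "x \<in> F" "u = N x \<inter> f -` B" using u v_def by auto
      have "open u" unfolding x(2) using N[OF x(1)] contf
        by (intro continuous_open_preimage) (auto simp: B_def intro: continuous_on_subset)
      then show ?thesis using N(3)[OF x(1)] x(2) by (intro open_subset) auto
    qed
    show "\<exists>q. homeomorphism u B f q" if u: "u \<in> v" for u
    proof -
      obtain x where x: "x \<in> F" "u = N x \<inter> f -` B" using u v_def by auto
      show ?thesis unfolding x(2) using N[OF x(1)] holf e(2) x(1) B_def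
        by (intro holomorphic_inj_homeomorphism) (auto intro: holomorphic_on_subset)
    qed
  qed
qed

text \<open>The fibres of \<open>exp\<close> are the orbits of translation by
  \<open>2\<pi>\<i>\<close>, so a function with this period factors through
  \<open>exp\<close>.\<close>

lemma periodic_descends_to_punctured_disc:
  fixes G :: "complex \<Rightarrow> complex"
  assumes holG: "G holomorphic_on {s. Re s < 0}"
    and per: "\<And>s. Re s < 0 \<Longrightarrow> G (s + 2 * of_real pi * \<i>) = G s"
  obtains F where "F holomorphic_on ball 0 1 - {0}" "\<And>s. Re s < 0 \<Longrightarrow> F (exp s) = G s"
proof -
  have pern: "G (s + of_int (2 * int n) * of_real pi * \<i>) = G s" if "Re s < 0" for s n
  proof (induction n)
    case (Suc n)
    have "G ((s + of_int (2 * int n) * of_real pi * \<i>) + 2 * of_real pi * \<i>) = G s"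
      using per[of "s + of_int (2 * int n) * of_real pi * \<i>"] that Suc by simp
    then show ?case by (simp add: algebra_simps)
  qed auto
  have eq: "G s = G s'" if "exp s = exp s'" "Re s < 0" for s s'
  proof -
    obtain n :: int where n: "s = s' + (of_int (2 * n) * of_real pi) * \<i>"
      using \<open>exp s = exp s'\<close> unfolding exp_eq by auto
    have "Re s' < 0" using that n by simp
    show ?thesis
    proof (cases "n \<ge> 0")
      case True
      then show ?thesis using pern[OF \<open>Re s' < 0\<close>, of "nat n"] n by simp
    next
      case False
      then have "s' = s + of_int (2 * int (nat (-n))) * of_real pi * \<i>" using n by (simp add: algebra_simps)
      then show ?thesis using pern[OF \<open>Re s < 0\<close>, of "nat (-n)"] by simp
    qed
  qed
  have Reneg: "Re s < 0" if "norm (exp s) < 1" for s using that by (simp add: norm_exp_eq_Re)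
  define F where "F t = G (Ln t)" for t
  show ?thesis
  proof
    show "F (exp s) = G s" if "Re s < 0" for s
      unfolding F_def using that by (intro eq[symmetric]) auto
    show "F holomorphic_on ball 0 1 - {0}"
      unfolding holomorphic_on_def
    proof
      fix t assume t: "t \<in> ball (0::complex) 1 - {0}"
      \<comment> \<open>The principal logarithm jumps across the negative axis. \<open>L\<close> is
        another right inverse of \<open>exp\<close>, differentiable at \<open>t\<close>; periodicity
        makes \<open>G \<circ> L\<close> agree with \<open>F\<close>.\<close>
      define L where "L u = Ln (u / t) + Ln t" for u
      have eL: "exp (L u) = u" if "u \<noteq> 0" for u using that t by (simp add: L_def exp_add)
      have "F u = (G \<circ> L) u" if "u \<in> ball 0 1 - {0}" for u
        unfolding F_def o_def using that eL[of u] by (intro eq Reneg) auto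
      moreover have "(G \<circ> L) field_differentiable at t within (ball 0 1 - {0})"
      proof -
        have "(L has_field_derivative (1/t)) (at t)" unfolding L_def
          using t by (auto intro!: derivative_eq_intros)
        then have "L field_differentiable at t" using field_differentiable_def by blast
        moreover have "Re (L t) < 0" using eL[of t] t by (intro Reneg) auto
        then have "G field_differentiable at (L t)"
          by (intro holomorphic_on_imp_differentiable_at[OF holG])
             (auto simp: open_halfspace_Re_lt)
        ultimately show ?thesis
          by (rule field_differentiable_at_within[OF field_differentiable_compose])
      qed
      ultimately show "F field_differentiable at t within (ball 0 1 - {0})"
        using t field_differentiable_transform_within[of 1 t "ball 0 1 - {0}" "G \<circ> L" F] by simp
    qed
  qed
qed

section \<open>Universal coverings of plane orbifolds by the disc\<close>

locale disc_orbifold_covering =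
  fixes U :: "complex set" and \<nu> :: "complex \<Rightarrow> nat" and \<pi> :: "complex \<Rightarrow> complex"
  assumes orbifold: "planar_orbifold U \<nu>"
    and covering: "orbifold_universal_covering U \<nu> \<pi>"
    and finite_ramified: "finite (ramified_points U \<nu>)"
begin

lemma open_U: "open U" and connected_U: "connected U" and U_nonempty: "U \<noteq> {}"
  using orbifold by (simp_all add: planar_orbifold_def)

lemma nu_pos: "z \<in> U \<Longrightarrow> \<nu> z \<ge> 1"
  using orbifold by (simp add: planar_orbifold_def)

lemma nu_unramified: "z \<in> U - ramified_points U \<nu> \<Longrightarrow> \<nu> z = 1"
  using nu_pos[of z] by (auto simp: ramified_points_def)

lemma holomorphic: "\<pi> holomorphic_on ball 0 1"
  and maps_into: "x \<in> ball 0 1 \<Longrightarrow> \<pi> x \<in> U"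
  and local_degree: "x \<in> ball 0 1 \<Longrightarrow> zorder (\<lambda>w. \<pi> w - \<pi> x) x = int (\<nu> (\<pi> x))"
  using covering
  by (auto simp: orbifold_universal_covering_def branched_covering_of_disc_def local_degree_def)

lemma continuous: "continuous_on (ball 0 1) \<pi>"
  using holomorphic holomorphic_on_imp_continuous_on by blast

text \<open>The definition of a branched covering in working form: properness becomes compactness of
  preimages, and maximality of the component \<open>W\<close> becomes a clause that traps any
  connected set through \<open>x\<close> lying over \<open>V\<close>.\<close>

lemma covered_neighbourhood:
  assumes "z \<in> U"
  obtains V where "open V" "z \<in> V" "V \<subseteq> U"
    "\<And>x. x \<in> ball 0 1 \<Longrightarrow> \<pi> x \<in> V \<Longrightarrow> \<exists>W. x \<in> W \<and> open W \<and> W \<subseteq> ball 0 1 \<and> \<pi> ` W = V \<and>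
       (\<forall>C. x \<in> C \<longrightarrow> connected C \<longrightarrow> C \<subseteq> ball 0 1 \<inter> \<pi> -` V \<longrightarrow> C \<subseteq> W) \<and>
       (\<forall>K\<subseteq>V. compact K \<longrightarrow> compact (W \<inter> \<pi> -` K))"
proof -
  obtain V where V: "open V" "z \<in> V" "V \<subseteq> U"
    and comp: "\<And>W. W \<in> components (ball 0 1 \<inter> \<pi> -` V) \<Longrightarrow>
            \<pi> ` W = V \<and> proper_map (top_of_set W) (top_of_set V) \<pi>"
    using covering assms
    unfolding orbifold_universal_covering_def branched_covering_of_disc_def by meson
  have op: "open (ball 0 1 \<inter> \<pi> -` V)"
    using continuous V(1) by (intro continuous_open_preimage) auto
  show ?thesis
  proof (rule that[OF V])
    fix x assume x: "x \<in> ball 0 1" "\<pi> x \<in> V"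
    define W where "W = connected_component_set (ball 0 1 \<inter> \<pi> -` V) x"
    have Wc: "W \<in> components (ball 0 1 \<inter> \<pi> -` V)"
      using x by (simp add: W_def componentsI)
    have "compact (W \<inter> \<pi> -` K)" if "K \<subseteq> V" "compact K" for K
    proof -
      have "compactin (top_of_set V) K" using that by (simp add: compactin_subtopology)
      then have "compactin (top_of_set W) {x \<in> W. \<pi> x \<in> K}"
        using compactin_proper_map_preimage comp[OF Wc] by fastforce
      then have "compact {x \<in> W. \<pi> x \<in> K}" by (simp add: compactin_subtopology)
      moreover have "{x \<in> W. \<pi> x \<in> K} = W \<inter> \<pi> -` K" by auto
      ultimately show ?thesis by simp
    qed
    moreover have "x \<in> W" using x by (simp add: W_def)
    moreover have "open W" using op by (simp add: W_def open_connected_component)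
    moreover have "W \<subseteq> ball 0 1" using in_components_subset[OF Wc] by blast
    moreover have "C \<subseteq> W" if "x \<in> C" "connected C" "C \<subseteq> ball 0 1 \<inter> \<pi> -` V" for C
      unfolding W_def using that by (intro connected_component_maximal)
    ultimately show "\<exists>W. x \<in> W \<and> open W \<and> W \<subseteq> ball 0 1 \<and> \<pi> ` W = V \<and>
       (\<forall>C. x \<in> C \<longrightarrow> connected C \<longrightarrow> C \<subseteq> ball 0 1 \<inter> \<pi> -` V \<longrightarrow> C \<subseteq> W) \<and>
       (\<forall>K\<subseteq>V. compact K \<longrightarrow> compact (W \<inter> \<pi> -` K))"
      using comp[OF Wc] by (intro exI[of _ W]) simp
  qed
qed

text \<open>A covered neighbourhood \<open>V\<close> is contained in the image as soon as it meets
  it, so the image is open and closed in the connected set \<open>U\<close>.\<close>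

lemma surjective: "\<pi> ` ball 0 1 = U"
proof -
  have sub: "\<pi> ` ball 0 1 \<subseteq> U" using maps_into by blast
  have "openin (top_of_set U) (\<pi> ` ball 0 1)"
  proof (subst openin_subopen, safe)
    fix x :: complex assume x: "x \<in> ball 0 1"
    obtain V where V: "open V" "\<pi> x \<in> V" "V \<subseteq> U" and "\<exists>W \<subseteq> ball 0 1. \<pi> ` W = V"
      using covered_neighbourhood[OF maps_into[OF x]] x by metis
    then have "V \<subseteq> \<pi> ` ball 0 1" by blast
    then show "\<exists>T. openin (top_of_set U) T \<and> \<pi> x \<in> T \<and> T \<subseteq> \<pi> ` ball 0 1"
      using V by (intro exI[of _ V]) (simp add: open_subset)
  qed
  moreover have "openin (top_of_set U) (U - \<pi> ` ball 0 1)"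
  proof (subst openin_subopen, safe)
    fix z assume z: "z \<in> U" "z \<notin> \<pi> ` ball 0 1"
    obtain V where V: "open V" "z \<in> V" "V \<subseteq> U"
      and ex: "\<And>x. x \<in> ball 0 1 \<Longrightarrow> \<pi> x \<in> V \<Longrightarrow> \<exists>W \<subseteq> ball 0 1. \<pi> ` W = V"
      using covered_neighbourhood[OF z(1)] by metis
    have "V \<subseteq> U - \<pi> ` ball 0 1" using ex V z(2) by blast
    then show "\<exists>T. openin (top_of_set U) T \<and> z \<in> T \<and> T \<subseteq> U - \<pi> ` ball 0 1"
      using V by (intro exI[of _ V]) (simp add: open_subset)
  qed
  ultimately have "\<pi> ` ball 0 1 = {} \<or> \<pi> ` ball 0 1 = U"
    using connected_clopen[THEN iffD1, OF connected_U] sub by (force simp: closedin_def)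
  then show ?thesis by auto
qed

lemma nonconstant: "\<exists>w\<in>ball 0 1. \<pi> w \<noteq> z"
proof (rule ccontr)
  assume "\<not> ?thesis"
  then have "U \<subseteq> {z}" using surjective by auto
  then have "U = {z}" using U_nonempty by blast
  then show False using open_U not_open_singleton[of z] by simp
qed

section \<open>Local normal form of the covering\<close>

text \<open>The local degree makes \<open>\<pi> - z\<close> equal to \<open>(w - x)^n\<close> times
  a nonvanishing \<open>g\<close>. On a disc \<open>g\<close> has a holomorphic logarithm, hence an
  \<open>n\<close>-th root, which is absorbed into \<open>\<phi>\<close>; then \<open>\<phi>\<close>
  has a simple zero at \<open>x\<close> and is injective nearby.\<close>

lemma local_power_form:
  assumes x: "x \<in> ball 0 1" and z: "\<pi> x = z"
  obtains \<rho> \<phi> where "\<rho> > 0" "cball x \<rho> \<subseteq> ball 0 1" "\<phi> holomorphic_on ball x \<rho>" "inj_on \<phi> (ball x \<rho>)"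
    "\<And>y. y \<in> ball x \<rho> \<Longrightarrow> \<pi> y = z + \<phi> y ^ \<nu> z" "\<And>y. y \<in> cball x \<rho> \<Longrightarrow> y \<noteq> x \<Longrightarrow> \<pi> y \<noteq> z"
proof -
  define f where "f = (\<lambda>w. \<pi> w - z)"
  define g where "g = zor_poly f x"
  have n: "zorder f x = int (\<nu> z)" using local_degree[OF x] z by (simp add: f_def)
  have npos: "\<nu> z > 0" using nu_pos maps_into[OF x] z by (simp add: Suc_le_eq)
  have holf: "f holomorphic_on ball 0 1"
    unfolding f_def by (intro holomorphic_intros holomorphic)
  have "\<exists>w\<in>ball 0 1. f w \<noteq> 0" using nonconstant by (simp add: f_def)
  from zorder_exist_zero[OF holf _ _ x this] obtain r where r: "r > 0" "cball x r \<subseteq> ball 0 1"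
    "g holomorphic_on cball x r" "\<And>w. w \<in> cball x r \<Longrightarrow> f w = g w * (w - x) ^ \<nu> z \<and> g w \<noteq> 0"
    unfolding n g_def by auto
  have holg: "g holomorphic_on ball x r" using r(3) by (rule holomorphic_on_subset) auto
  obtain l where l: "l holomorphic_on ball x r" "\<And>w. w \<in> ball x r \<Longrightarrow> g w = exp (l w)"
    by (rule contractible_imp_holomorphic_log[OF holg]) (use r(4) in \<open>auto simp: convex_imp_contractible\<close>)
  define \<phi> where "\<phi> w = (w - x) * exp (l w / of_nat (\<nu> z))" for w
  have hol\<phi>: "\<phi> holomorphic_on ball x r"
    unfolding \<phi>_def by (intro holomorphic_intros l) (use npos in auto)
  have pow: "\<pi> y = z + \<phi> y ^ \<nu> z" if y: "y \<in> ball x r" for y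
  proof -
    have "exp (l y / of_nat (\<nu> z)) ^ \<nu> z = g y"
      using l(2)[OF y] npos by (simp add: exp_of_nat_mult[symmetric])
    then have "\<phi> y ^ \<nu> z = g y * (y - x) ^ \<nu> z"
      by (simp add: \<phi>_def power_mult_distrib)
    then show ?thesis using r(4)[of y] y by (simp add: f_def algebra_simps)
  qed
  have dl: "(l has_field_derivative deriv l x) (at x)"
    using holomorphic_derivI[OF l(1)] r(1) by simp
  have "(\<phi> has_field_derivative exp (l x / of_nat (\<nu> z))) (at x)"
    unfolding \<phi>_def using npos by (auto intro!: derivative_eq_intros dl)
  then have "deriv \<phi> x \<noteq> 0" using DERIV_imp_deriv by fastforce
  then obtain r' where r': "r' > 0" "ball x r' \<subseteq> ball x r" "inj_on \<phi> (ball x r')"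
    using has_complex_derivative_locally_injective[OF hol\<phi>, of x] r(1) by auto
  \<comment> \<open>Halving the radius leaves room for the closed ball, so \<open>z\<close> is not
    taken on its boundary sphere either.\<close>
  have cb: "cball x (r'/2) \<subseteq> ball x r" using r'(1,2) by force
  have b: "ball x (r'/2) \<subseteq> ball x r'" "ball x (r'/2) \<subseteq> ball x r" using r'(1) cb by auto
  show ?thesis
  proof (rule that[of "r'/2" \<phi>])
    show "0 < r'/2" using r' by simp
    show "cball x (r'/2) \<subseteq> ball 0 1" using cb r(2) ball_subset_cball by blast
    show "\<phi> holomorphic_on ball x (r'/2)" using hol\<phi> b holomorphic_on_subset by blast
    show "inj_on \<phi> (ball x (r'/2))" using r'(3) b inj_on_subset by blast
    show "\<pi> y = z + \<phi> y ^ \<nu> z" if "y \<in> ball x (r'/2)" for y using pow that b by blast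
    show "\<pi> y \<noteq> z" if "y \<in> cball x (r'/2)" "y \<noteq> x" for y
    proof -
      have "y \<in> cball x r" using that cb ball_subset_cball by blast
      then have "f y \<noteq> 0" using r(4)[of y] that(2) by simp
      then show ?thesis by (simp add: f_def)
    qed
  qed
qed

text \<open>With exponent \<open>1\<close> the normal form is a translate of the injective
  \<open>\<phi>\<close>, and an injective holomorphic map has nonvanishing derivative.\<close>

lemma deriv_nonzero:
  assumes x: "x \<in> ball 0 1" and u: "\<nu> (\<pi> x) = 1"
  shows "deriv \<pi> x \<noteq> 0"
proof -
  obtain \<rho> \<phi> where \<rho>: "\<rho> > 0" "cball x \<rho> \<subseteq> ball 0 1" "inj_on \<phi> (ball x \<rho>)"
    "\<And>y. y \<in> ball x \<rho> \<Longrightarrow> \<pi> y = \<pi> x + \<phi> y ^ \<nu> (\<pi> x)"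
    using local_power_form[OF x refl] by metis
  have "\<pi> holomorphic_on ball x \<rho>"
    using holomorphic \<rho>(2) ball_subset_cball holomorphic_on_subset by (meson subset_trans)
  moreover have "inj_on \<pi> (ball x \<rho>)"
    using \<rho>(3,4) u by (simp add: inj_on_def)
  ultimately show ?thesis using \<rho>(1) by (intro holomorphic_injective_imp_regular) auto
qed

lemma closed_ramified: "closed (ramified_points U \<nu>)"
  using finite_ramified finite_imp_closed by blast

section \<open>The unbranched covering over the unramified points\<close>

text \<open>Over \<open>T\<close> the restriction of \<open>\<pi>\<close> to \<open>W\<close> is
  proper and unbranched, hence a covering; as \<open>T\<close> is convex, the identity of
  \<open>T\<close> lifts through it.\<close>

lemma local_section:
  assumes V: "open T" "convex T" "T \<subseteq> V" "V \<subseteq> U" "T \<inter> ramified_points U \<nu> = {}"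
    and x: "x \<in> W" "\<pi> x \<in> T"
    and W: "open W" "W \<subseteq> ball 0 1" "\<pi> ` W = V" "\<forall>K\<subseteq>V. compact K \<longrightarrow> compact (W \<inter> \<pi> -` K)"
  shows "\<exists>\<sigma>. continuous_on T \<sigma> \<and> \<sigma> ` T \<subseteq> ball 0 1 \<and> (\<forall>t\<in>T. \<pi> (\<sigma> t) = t) \<and> \<sigma> (\<pi> x) = x"
proof -
  define Y where "Y = W \<inter> \<pi> -` T"
  have "Y \<subseteq> ball 0 1" using W(2) by (auto simp: Y_def)
  have cov: "covering_space Y \<pi> T"
  proof (rule proper_local_homeo_covering_space)
    show "\<pi> holomorphic_on Y" using holomorphic \<open>Y \<subseteq> ball 0 1\<close> holomorphic_on_subset by blast
    show "open Y" unfolding Y_def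
      using W(1,2) V(1) continuous by (intro continuous_open_preimage) (auto intro: continuous_on_subset)
    show "open T" by fact
    show "\<pi> ` Y = T" using W(3) V(3) by (auto simp: Y_def)
    show "deriv \<pi> y \<noteq> 0" if "y \<in> Y" for y
    proof (rule deriv_nonzero)
      show "y \<in> ball 0 1" using that \<open>Y \<subseteq> ball 0 1\<close> by blast
      have "\<pi> y \<in> U - ramified_points U \<nu>" using that V by (auto simp: Y_def)
      then show "\<nu> (\<pi> y) = 1" by (rule nu_unramified)
    qed
    fix K assume K: "K \<subseteq> T" "compact K"
    have "Y \<inter> \<pi> -` K = W \<inter> \<pi> -` K" using K(1) by (auto simp: Y_def)
    then show "compact (Y \<inter> \<pi> -` K)" using W(4) K V(3) by simp
  qed
  obtain \<sigma> where "continuous_on T \<sigma>" "\<sigma> \<in> T \<rightarrow> Y" "\<sigma> (\<pi> x) = x" "\<And>t. t \<in> T \<Longrightarrow> \<pi> (\<sigma> t) = t"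
    by (rule covering_space_lift_strong[OF cov, of x "\<pi> x" T "\<lambda>t. t"])
      (use x V in \<open>auto simp: Y_def convex_imp_simply_connected convex_imp_locally_path_connected\<close>)
  then show ?thesis using \<open>Y \<subseteq> ball 0 1\<close> by (intro exI[of _ \<sigma>]) auto
qed

text \<open>Properness is given one component at a time, and a fibre may meet many components. The
  sheets over a disc \<open>T\<close> are therefore taken to be the images of all sections over
  \<open>T\<close>: every point above \<open>T\<close> lies on one, and two that meet
  coincide.\<close>

lemma covering_space_unramified:
  "covering_space (ball 0 1 - \<pi> -` ramified_points U \<nu>) \<pi> (U - ramified_points U \<nu>)"
proof
  define R where "R = ramified_points U \<nu>"
  show "continuous_on (ball 0 1 - \<pi> -` ramified_points U \<nu>) \<pi>"
    using continuous by (rule continuous_on_subset) auto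
  show "\<pi> ` (ball 0 1 - \<pi> -` ramified_points U \<nu>) = U - ramified_points U \<nu>"
    using surjective by auto
  fix z assume z: "z \<in> U - ramified_points U \<nu>"
  then obtain V where V: "open V" "z \<in> V" "V \<subseteq> U"
    and W: "\<And>x. x \<in> ball 0 1 \<Longrightarrow> \<pi> x \<in> V \<Longrightarrow> \<exists>W. x \<in> W \<and> open W \<and> W \<subseteq> ball 0 1 \<and> \<pi> ` W = V \<and>
       (\<forall>K\<subseteq>V. compact K \<longrightarrow> compact (W \<inter> \<pi> -` K))"
    using covered_neighbourhood[of z] by (metis DiffD1)
  have "open (V - R)" "z \<in> V - R" using V z closed_ramified by (auto simp: R_def)
  then obtain e where e: "e > 0" "ball z e \<subseteq> V - R" using openE by blast
  define T where "T = ball z e"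
  have T: "open T" "convex T" "T \<subseteq> V" "T \<inter> R = {}" "z \<in> T" "connected T"
    using e by (auto simp: T_def)
  define S where "S = {\<sigma>. continuous_on T \<sigma> \<and> \<sigma> ` T \<subseteq> ball 0 1 \<and> (\<forall>t\<in>T. \<pi> (\<sigma> t) = t)}"
  define v where "v = (\<lambda>\<sigma>. \<sigma> ` T) ` S"
  have S: "continuous_on T \<sigma>" "\<sigma> ` T \<subseteq> ball 0 1" "\<And>t. t \<in> T \<Longrightarrow> \<pi> (\<sigma> t) = t" if "\<sigma> \<in> S" for \<sigma>
    using that by (auto simp: S_def)
  have inS: "\<exists>\<sigma>\<in>S. \<sigma> (\<pi> x) = x" if x: "x \<in> ball 0 1" "\<pi> x \<in> T" for x
  proof -
    obtain W where W': "x \<in> W" "open W" "W \<subseteq> ball 0 1" "\<pi> ` W = V"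
       "\<forall>K\<subseteq>V. compact K \<longrightarrow> compact (W \<inter> \<pi> -` K)" using W[of x] x T(3) by blast
    show ?thesis
      using local_section[OF T(1-3) V(3) T(4)[unfolded R_def] W'(1) x(2) W'(2-5)]
      unfolding S_def by blast
  qed
  have inj: "\<exists>N. open N \<and> x \<in> N \<and> inj_on \<pi> N" if x: "x \<in> ball 0 1" "\<pi> x \<in> T" for x
  proof -
    have "deriv \<pi> x \<noteq> 0"
      using x T V by (intro deriv_nonzero nu_unramified) (auto simp: R_def)
    then obtain r where "r > 0" "inj_on \<pi> (ball x r)"
      using has_complex_derivative_locally_injective[OF holomorphic x(1)] by auto
    then show ?thesis by (intro exI[of _ "ball x r"]) auto
  qed
  have TU: "T \<subseteq> U - R" using T(3,4) V(3) by blast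
  have subC: "\<sigma> ` T \<subseteq> ball 0 1 - \<pi> -` R" if "\<sigma> \<in> S" for \<sigma>
    using S[OF that] T(4) by fastforce
  show "\<exists>T. z \<in> T \<and> openin (top_of_set (U - ramified_points U \<nu>)) T \<and>
         (\<exists>v. \<Union> v = (ball 0 1 - \<pi> -` ramified_points U \<nu>) \<inter> \<pi> -` T \<and>
            (\<forall>u\<in>v. openin (top_of_set (ball 0 1 - \<pi> -` ramified_points U \<nu>)) u) \<and>
            pairwise disjnt v \<and> (\<forall>u\<in>v. \<exists>q. homeomorphism u T \<pi> q))"
    unfolding R_def[symmetric]
  proof (intro exI[of _ T] exI[of _ v] conjI ballI)
    show "z \<in> T" by fact
    show "openin (top_of_set (U - R)) T" using TU T(1) by (simp add: open_subset)
    show "\<Union> v = (ball 0 1 - \<pi> -` R) \<inter> \<pi> -` T"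
    proof
      show "\<Union> v \<subseteq> (ball 0 1 - \<pi> -` R) \<inter> \<pi> -` T" using subC S(3) by (fastforce simp: v_def)
      show "(ball 0 1 - \<pi> -` R) \<inter> \<pi> -` T \<subseteq> \<Union> v"
      proof
        fix x assume x: "x \<in> (ball 0 1 - \<pi> -` R) \<inter> \<pi> -` T"
        then obtain \<sigma> where "\<sigma> \<in> S" "\<sigma> (\<pi> x) = x" using inS[of x] by auto
        then have "x \<in> \<sigma> ` T" using x by (metis IntD2 image_eqI vimageD)
        with \<open>\<sigma> \<in> S\<close> show "x \<in> \<Union> v" by (auto simp: v_def)
      qed
    qed
    show "openin (top_of_set (ball 0 1 - \<pi> -` R)) u" if u: "u \<in> v" for u
    proof -
      obtain \<sigma> where \<sigma>: "\<sigma> \<in> S" "u = \<sigma> ` T" using u by (auto simp: v_def)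
      \<comment> \<open>A section is injective because \<open>\<pi>\<close> is a left inverse, so
        invariance of domain makes its image open.\<close>
      have "inj_on \<sigma> T" using S(3)[OF \<sigma>(1)] by (rule inj_on_inverseI)
      then have "open (\<sigma> ` T)" using S(1)[OF \<sigma>(1)] T(1) by (intro invariance_of_domain)
      then show ?thesis using subC[OF \<sigma>(1)] \<sigma>(2) by (simp add: open_subset)
    qed
    have "\<sigma> ` T = \<tau> ` T" if st: "\<sigma> \<in> S" "\<tau> \<in> S" and ne: "\<sigma> ` T \<inter> \<tau> ` T \<noteq> {}" for \<sigma> \<tau>
    proof -
      obtain a b where ab: "a \<in> T" "b \<in> T" "\<sigma> a = \<tau> b" using ne by auto
      have "a = b" using S(3)[OF st(1) ab(1)] S(3)[OF st(2) ab(2)] ab(3) by simp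
      have nb: "\<exists>N. open N \<and> \<sigma> t \<in> N \<and> inj_on \<pi> N" if "t \<in> T" for t
        using inj[of "\<sigma> t"] S(2,3)[OF st(1)] that by auto
      have "\<sigma> t = \<tau> t" if "t \<in> T" for t
        by (rule section_unique[OF T(6) S(1)[OF st(1)] S(1)[OF st(2)] S(3)[OF st(1)] S(3)[OF st(2)] nb])
          (use ab \<open>a = b\<close> that in auto)
      then show ?thesis by auto
    qed
    then show "pairwise disjnt v"
      unfolding v_def pairwise_image pairwise_def disjnt_def by blast
    show "\<exists>q. homeomorphism u T \<pi> q" if u: "u \<in> v" for u
    proof -
      obtain \<sigma> where \<sigma>: "\<sigma> \<in> S" "u = \<sigma> ` T" using u by (auto simp: v_def)
      have "homeomorphism (\<sigma> ` T) T \<pi> \<sigma>"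
      proof (rule homeomorphismI)
        show "continuous_on (\<sigma> ` T) \<pi>" using continuous S(2)[OF \<sigma>(1)] continuous_on_subset by blast
      qed (use S[OF \<sigma>(1)] in auto)
      then show ?thesis using \<sigma>(2) by blast
    qed
  qed
qed

section \<open>Lifting the power map and bounding the density\<close>

text \<open>The punctured disc is not simply connected, so the map is first lifted after the
  substitution \<open>t = exp s\<close> on the left half-plane. The lift \<open>G\<close> turns out
  to have period \<open>2\<pi>\<i>\<close>, descends to the punctured disc, and extends over the
  puncture because it is bounded.\<close>

lemma lift_power_disc:
  assumes d: "d > 0" "ball z d \<subseteq> U" "ramified_points U \<nu> \<inter> ball z d \<subseteq> {z}"
    and x: "x \<in> ball 0 1" and t0: "norm t0 < 1" "t0 \<noteq> 0"
    and px: "\<pi> x = z + of_real d * t0 ^ \<nu> z"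
  obtains F where "F holomorphic_on ball 0 1" "\<And>t. norm t < 1 \<Longrightarrow> norm (F t) < 1" "F t0 = x"
    "\<And>t. norm t < 1 \<Longrightarrow> \<pi> (F t) = z + of_real d * t ^ \<nu> z"
proof -
  define n where "n = \<nu> z"
  define R where "R = ramified_points U \<nu>"
  define C where "C = ball 0 1 - \<pi> -` R"
  define H where "H = {s. Re s < 0}"
  define h where "h s = z + of_real d * exp s ^ n" for s
  have zU: "z \<in> U" using d by auto
  have n1: "n \<ge> 1" using nu_pos[OF zU] by (simp add: n_def)
  have cov: "covering_space C \<pi> (U - R)"
    using covering_space_unramified by (simp add: C_def R_def)
  have "C = ball 0 1 \<inter> \<pi> -` (- R)" by (auto simp: C_def)
  moreover have "open (ball 0 1 \<inter> \<pi> -` (- R))"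
    using closed_ramified continuous by (intro continuous_open_preimage) (auto simp: R_def)
  ultimately have openC: "open C" by simp
  have holC: "\<pi> holomorphic_on C" using holomorphic by (rule holomorphic_on_subset) (auto simp: C_def)
  have disth: "dist (h s) z = d * exp (Re s) ^ n" for s
    using d(1) by (simp add: h_def dist_norm norm_mult norm_power)
  have hlt: "dist (h s) z < e" if "Re s < 0" "Re s < ln (e / d)" "e > 0" for s e
  proof -
    \<comment> \<open>For \<open>Re s < 0\<close> the power \<open>n\<close> only decreases the
      modulus, so the threshold for \<open>Re s\<close> does not involve \<open>n\<close>.\<close>
    have "exp (Re s) ^ n \<le> exp (Re s) ^ 1" using that(1) n1 by (intro power_decreasing) auto
    also have "\<dots> < e / d" using that d(1) by (simp add: ln_ge_iff[symmetric] less_le_not_le) (metis divide_pos_pos exp_less_cancel_iff exp_ln less_le_not_le)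
    finally show ?thesis unfolding disth using d(1) by (simp add: field_simps)
  qed
  have him: "h s \<in> U - R" if "s \<in> H" for s
  proof -
    have "dist (h s) z < d" using that d(1) hlt[of s d] by (simp add: H_def)
    then have "h s \<in> ball z d" by (simp add: dist_commute)
    moreover have "h s \<noteq> z" using d(1) by (simp add: h_def)
    ultimately show ?thesis using d(2,3) by (auto simp: R_def)
  qed
  have holh: "h holomorphic_on H" unfolding h_def by (intro holomorphic_intros)
  have contH: "continuous_on S h" for S unfolding h_def by (intro continuous_intros)
  have "convex H" unfolding H_def by (rule convex_halfspace_Re_lt)
  have L: "Ln t0 \<in> H" "exp (Ln t0) = t0" using t0 by (auto simp: H_def)
  have hL: "h (Ln t0) = \<pi> x" using px L by (simp add: h_def n_def)
  have xC: "x \<in> C" using x him[OF L(1)] by (simp add: C_def hL)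
  obtain G where G: "continuous_on H G" "G \<in> H \<rightarrow> C" "G (Ln t0) = x" "\<And>s. s \<in> H \<Longrightarrow> \<pi> (G s) = h s"
    by (rule covering_space_lift_strong[OF cov xC L(1) _ _ contH _ hL])
      (use \<open>convex H\<close> him in \<open>auto simp: convex_imp_simply_connected convex_imp_locally_path_connected\<close>)
  have holG: "G holomorphic_on H"
    by (rule covering_space_lift_is_holomorphic[OF cov openC holC holh _ G(2,1,4)]) (use him in auto)
  have G1: "G s \<in> ball 0 1" if "s \<in> H" for s using G(2) that by (auto simp: C_def)

  \<comment> \<open>As \<open>Re s\<close> tends to \<open>-\<infinity>\<close>, \<open>G s\<close> is trapped near a point \<open>x0\<close> above \<open>z\<close>, where
    \<open>\<pi> = z + \<phi>\<^sup>n\<close>.  Hence \<open>\<phi> (G s)\<close> is a constant multiple of \<open>exp s\<close>, and \<open>G\<close> is periodic.\<close>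
  define E where "E a = {s::complex. Re s < - a}" for a :: real
  have EH: "E a \<subseteq> H" if "a \<ge> 0" for a using that by (auto simp: E_def H_def)
  have connE: "connected (G ` E a)" if "a \<ge> 0" for a
  proof (rule connected_continuous_image)
    show "continuous_on (E a) G" using G(1) EH[OF that] continuous_on_subset by blast
    show "connected (E a)" unfolding E_def by (intro convex_connected convex_halfspace_Re_lt)
  qed
  have tail: "\<exists>a\<ge>0. \<forall>s\<in>E a. dist (h s) z < e" if "e > 0" for e
    using hlt[OF _ _ that] 
    by (intro exI[of _ "max 0 (- ln (e / d))"]) (auto simp: E_def)

  obtain V where V: "open V" "z \<in> V" "V \<subseteq> U" and
    VW: "\<And>x. x \<in> ball 0 1 \<Longrightarrow> \<pi> x \<in> V \<Longrightarrow> \<exists>W. x \<in> W \<and> open W \<and> W \<subseteq> ball 0 1 \<and> \<pi> ` W = V \<and>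
       (\<forall>C. x \<in> C \<longrightarrow> connected C \<longrightarrow> C \<subseteq> ball 0 1 \<inter> \<pi> -` V \<longrightarrow> C \<subseteq> W) \<and>
       (\<forall>K\<subseteq>V. compact K \<longrightarrow> compact (W \<inter> \<pi> -` K))"
    using covered_neighbourhood[OF zU] by metis
  obtain e where e: "e > 0" "cball z e \<subseteq> V" using V open_contains_cball by blast
  obtain a where a: "a \<ge> 0" "\<And>s. s \<in> E a \<Longrightarrow> dist (h s) z < e" using tail[OF e(1)] by blast
  \<comment> \<open>Points running to \<open>-\<infinity>\<close> along the real axis. Their images
    under \<open>G\<close> will lie in a compact part of \<open>W\<close>, which yields the limit
    point \<open>x0\<close>; the summand \<open>1\<close> puts \<open>s 0\<close> strictly inside
    \<open>E a\<close>.\<close>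
  define s :: "nat \<Rightarrow> complex" where "s k = of_real (- (a + 1 + real k))" for k
  have sE: "s k \<in> E a" for k by (simp add: s_def E_def)
  have GE: "G ` E a \<subseteq> ball 0 1 \<inter> \<pi> -` cball z e"
    using G1 G(4) EH[OF a(1)] a(2) by (fastforce simp: dist_commute)
  have "G (s 0) \<in> ball 0 1" "\<pi> (G (s 0)) \<in> V" using GE sE[of 0] e(2) by auto
  from VW[OF this] obtain W where W: "W \<subseteq> ball 0 1"
    "\<And>C. G (s 0) \<in> C \<Longrightarrow> connected C \<Longrightarrow> C \<subseteq> ball 0 1 \<inter> \<pi> -` V \<Longrightarrow> C \<subseteq> W"
    "\<And>K. K \<subseteq> V \<Longrightarrow> compact K \<Longrightarrow> compact (W \<inter> \<pi> -` K)" by blast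
  have "G ` E a \<subseteq> ball 0 1 \<inter> \<pi> -` V" using GE e(2) by blast
  \<comment> \<open>The image of the half-plane is connected, so maximality of \<open>W\<close>
    keeps all of it in one component.\<close>
  then have "G ` E a \<subseteq> W" using sE by (intro W(2) connE a(1)) auto
  then have Gs: "G (s k) \<in> W \<inter> \<pi> -` cball z e" for k using GE sE[of k] by blast
  obtain x0 r where x0: "x0 \<in> W \<inter> \<pi> -` cball z e" "strict_mono r" "((\<lambda>k. G (s k)) \<circ> r) \<longlonglongrightarrow> x0"
    using W(3)[OF e(2) compact_cball] Gs unfolding compact_def by metis
  have x0D: "x0 \<in> ball 0 1" using x0(1) W(1) by blast
  have reE: "eventually (\<lambda>k. s (r k) \<in> E b) sequentially" for b
  proof -
    have "s k \<in> E b" if "k > nat \<lceil>b\<rceil>" for k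
    proof -
      have "b < real k" using that by linarith
      then show ?thesis using a(1) by (simp add: s_def E_def)
    qed
    then have "eventually (\<lambda>k. s k \<in> E b) sequentially"
      using eventually_gt_at_top[of "nat \<lceil>b\<rceil>"] by (rule eventually_mono[rotated])
    then show ?thesis by (rule eventually_subseq[OF x0(2)])
  qed
  have "(\<lambda>k. h (s (r k))) \<longlonglongrightarrow> z"
  proof (rule tendstoI)
    fix e' :: real assume "e' > 0"
    then obtain b where "\<forall>s\<in>E b. dist (h s) z < e'" using tail by blast
    then show "eventually (\<lambda>k. dist (h (s (r k))) z < e') sequentially"
      using reE[of b] by (auto elim: eventually_mono)
  qed
  moreover have "(\<lambda>k. \<pi> (G (s (r k)))) \<longlonglongrightarrow> \<pi> x0"
    using x0(3) continuous x0D G1 sE EH[OF a(1)]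
    by (intro continuous_on_tendsto_compose[OF continuous]) (auto simp: o_def subset_iff)
  moreover have "\<pi> (G (s (r k))) = h (s (r k))" for k
    using sE EH[OF a(1)] G(4) by blast
  ultimately have px0: "\<pi> x0 = z" using LIMSEQ_unique by fastforce

  obtain \<rho> \<phi> where \<rho>: "\<rho> > 0" "cball x0 \<rho> \<subseteq> ball 0 1"
    and hol\<phi>: "\<phi> holomorphic_on ball x0 \<rho>" and inj\<phi>: "inj_on \<phi> (ball x0 \<rho>)"
    and \<phi>: "\<And>y. y \<in> ball x0 \<rho> \<Longrightarrow> \<pi> y = z + \<phi> y ^ n"
    and \<rho>z: "\<And>y. y \<in> cball x0 \<rho> \<Longrightarrow> y \<noteq> x0 \<Longrightarrow> \<pi> y \<noteq> z"
    using local_power_form[OF x0D px0] unfolding n_def by metis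
  have "\<exists>\<epsilon>>0. \<forall>y\<in>sphere x0 \<rho>. \<epsilon> \<le> dist (\<pi> y) z"
  proof -
    have "sphere x0 \<rho> \<noteq> {}" using \<rho>(1) by simp
    moreover have "continuous_on (sphere x0 \<rho>) (\<lambda>y. dist (\<pi> y) z)"
      using \<rho>(2) sphere_cball by (intro continuous_intros continuous_on_subset[OF continuous]) blast
    ultimately obtain y where "y \<in> sphere x0 \<rho>" "\<And>y'. y' \<in> sphere x0 \<rho> \<Longrightarrow> dist (\<pi> y) z \<le> dist (\<pi> y') z"
      using continuous_attains_inf[OF compact_sphere] by blast
    then show ?thesis using \<rho>z[of y] \<rho>(1)
      by (intro exI[of _ "dist (\<pi> y) z"]) auto
  qed
  then obtain \<epsilon> where \<epsilon>: "\<epsilon> > 0" "\<And>y. y \<in> sphere x0 \<rho> \<Longrightarrow> \<epsilon> \<le> dist (\<pi> y) z" by blast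
  obtain b where b: "b \<ge> 0" "\<And>s. s \<in> E b \<Longrightarrow> dist (h s) z < \<epsilon>" using tail[OF \<epsilon>(1)] by blast
  \<comment> \<open>Convergence along a subsequence only places some points near \<open>x0\<close>.
    But \<open>h\<close> is within \<open>\<epsilon>\<close> of \<open>z\<close> on
    \<open>E b\<close>, while \<open>\<pi>\<close> stays at least \<open>\<epsilon>\<close> from
    \<open>z\<close> on the sphere, so the connected image cannot cross it.\<close>
  have Gball: "G ` E b \<subseteq> ball x0 \<rho>"
  proof -
    have "eventually (\<lambda>k. dist (G (s (r k))) x0 < \<rho>) sequentially"
      using tendstoD[OF x0(3) \<rho>(1)] by (simp add: o_def)
    then have "eventually (\<lambda>k. dist (G (s (r k))) x0 < \<rho> \<and> s (r k) \<in> E b) sequentially"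
      using reE[of b] by (rule eventually_conj)
    then obtain k where "dist (G (s (r k))) x0 < \<rho>" "s (r k) \<in> E b"
      by (auto simp: eventually_sequentially)
    then have "G ` E b \<inter> ball x0 \<rho> \<noteq> {}" by (auto simp: dist_commute)
    moreover have "G ` E b \<inter> sphere x0 \<rho> = {}"
      using \<epsilon>(2) b(2) G(4) EH[OF b(1)] by (fastforce simp: subset_iff)
    ultimately show ?thesis
      using connected_Int_frontier[OF connE[OF b(1)], of "ball x0 \<rho>"] \<rho>(1)
      by (auto simp: frontier_ball)
  qed
  define q where "q s = \<phi> (G s) / exp s" for s
  have "q constant_on E b"
  proof (rule continuous_finite_range_constant)
    show "connected (E b)" unfolding E_def by (intro convex_connected convex_halfspace_Re_lt)
    have cG: "continuous_on (E b) G" using G(1) EH[OF b(1)] continuous_on_subset by blast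
    show "continuous_on (E b) q"
      unfolding q_def
      by (intro continuous_intros continuous_on_compose2[OF holomorphic_on_imp_continuous_on[OF hol\<phi>] cG])
        (use Gball in auto)
    \<comment> \<open>The values of \<open>q\<close> are \<open>n\<close>-th roots of
      \<open>d\<close>, finitely many; continuity on a connected set then makes \<open>q\<close>
      constant.\<close>
    have "q s ^ n = of_real d" if "s \<in> E b" for s
    proof -
      have "z + \<phi> (G s) ^ n = h s" using \<phi> Gball that G(4) EH[OF b(1)] by force
      then show ?thesis by (simp add: q_def h_def power_divide)
    qed
    then have "q ` E b \<subseteq> {w. w ^ n = of_real d}" by auto
    moreover have "finite {w::complex. w ^ n = of_real d}"
      using n1 by (intro finite_nth_roots) auto
    ultimately show "finite (q ` E b)" by (rule finite_subset)
  qed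
  then have qeq: "q s = q t" if "s \<in> E b" "t \<in> E b" for s t
    using that unfolding constant_on_def by metis
  define w where "w = 2 * of_real pi * \<i>"
  have Rew: "Re w = 0" by (simp add: w_def)
  have expw: "exp (s + w) = exp s" for s by (simp add: w_def exp_plus_2pin exp_add)
  have perE: "G (s + w) = G s" if "s \<in> E b" for s
  proof -
    have sw: "s + w \<in> E b" using that Rew by (simp add: E_def)
    have "\<phi> (G (s + w)) = \<phi> (G s)" using qeq[OF sw that] by (simp add: q_def expw)
    then show ?thesis using inj_onD[OF inj\<phi>] Gball sw that by blast
  qed
  \<comment> \<open>Both \<open>G\<close> and its translate lift \<open>h\<close>, and they agree at
    a point of \<open>E b\<close>. Uniqueness of lifts spreads the period from \<open>E b\<close> to
    the whole half-plane.\<close>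
  have per: "G (s + w) = G s" if "Re s < 0" for s
  proof (rule covering_space_lift_unique[OF cov, of "\<lambda>s. G (s + w)" "of_real (- (b + 1))" G H h])
    have "(\<lambda>s. s + w) ` H \<subseteq> H" using Rew by (auto simp: H_def)
    then show "continuous_on H (\<lambda>s. G (s + w))"
      by (intro continuous_on_compose2[OF G(1)] continuous_intros)
    show "(\<lambda>s. G (s + w)) \<in> H \<rightarrow> C" using G(2) Rew by (auto simp: H_def)
    show "h s = \<pi> (G (s + w))" if "s \<in> H" for s
      using G(4)[of "s + w"] that Rew by (simp add: H_def h_def expw)
    show "connected H" using \<open>convex H\<close> by (rule convex_connected)
    show "of_real (- (b + 1)) \<in> H" using b(1) by (simp add: H_def)
    show "s \<in> H" using that by (simp add: H_def)
    show "G (of_real (- (b + 1)) + w) = G (of_real (- (b + 1)))" by (rule perE) (simp add: E_def)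
  qed (use G him contH in auto)
  obtain F0 where F0: "F0 holomorphic_on ball 0 1 - {0}" "\<And>s. Re s < 0 \<Longrightarrow> F0 (exp s) = G s"
    using periodic_descends_to_punctured_disc[OF holG[unfolded H_def] per[unfolded w_def]] by metis
  have F0': "F0 t = G (Ln t) \<and> Ln t \<in> H" if "norm t < 1" "t \<noteq> 0" for t
    using F0(2)[of "Ln t"] that by (simp add: H_def)
  have "\<exists>F. F holomorphic_on ball 0 1 \<and> (\<forall>t\<in>ball 0 1 - {0}. F t = F0 t)"
  proof (subst holomorphic_on_extend_bounded[OF F0(1)])
    have "eventually (\<lambda>t. t \<in> ball 0 1 - {0}) (at (0::complex))"
      by (rule eventually_at_in_open) auto
    then have "eventually (\<lambda>t. norm (F0 t) \<le> 1) (at 0)"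
      by eventually_elim (use F0' G1 in \<open>force simp: less_imp_le\<close>)
    then show "\<exists>B. eventually (\<lambda>t. norm (F0 t) \<le> B) (at 0)" ..
  qed auto
  then obtain F where F: "F holomorphic_on ball 0 1" "\<And>t. t \<in> ball 0 1 - {0} \<Longrightarrow> F t = F0 t" by blast
  have FG: "F t = G (Ln t)" "Ln t \<in> H" if "norm t < 1" "t \<noteq> 0" for t
    using F(2)[of t] F0'[OF that] that by auto
  \<comment> \<open>Boundedness alone would allow \<open>norm (F 0) = 1\<close>. Identifying the
    value as \<open>x0\<close> places it inside the disc and above \<open>z\<close>.\<close>
  have F00: "F 0 = x0"
  proof -
    have "(\<lambda>k. exp (s (r k))) \<longlonglongrightarrow> 0"
    proof (rule tendstoI)
      fix e' :: real assume e': "e' > 0"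
      have "norm (exp s) < e'" if "s \<in> E (- ln e')" for s
        using that e' by (simp add: E_def) (metis exp_less_cancel_iff exp_ln)
      then show "eventually (\<lambda>k. dist (exp (s (r k))) 0 < e') sequentially"
        using reE[of "- ln e'"] by (auto elim!: eventually_mono)
    qed
    then have "(\<lambda>k. F (exp (s (r k)))) \<longlonglongrightarrow> F 0"
      using sE EH[OF a(1)]
      by (intro continuous_on_tendsto_compose[OF holomorphic_on_imp_continuous_on[OF F(1)]])
         (auto simp: H_def subset_iff)
    moreover have "F (exp (s (r k))) = G (s (r k))" for k
    proof -
      have "Re (s (r k)) < 0" using sE[of "r k"] EH[OF a(1)] by (auto simp: H_def)
      then show ?thesis using F(2)[of "exp (s (r k))"] F0(2) by simp
    qed
    ultimately show ?thesis using x0(3) LIMSEQ_unique by (auto simp: o_def)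
  qed
  show ?thesis
  proof (rule that[OF F(1)])
    show "norm (F t) < 1" if "norm t < 1" for t
      using FG[OF that] G1 F00 x0D by (cases "t = 0") auto
    show "F t0 = x" using FG[OF t0] G(3) by simp
    show "\<pi> (F t) = z + of_real d * t ^ \<nu> z" if "norm t < 1" for t
    proof (cases "t = 0")
      case True
      then show ?thesis using F00 px0 n1 by (simp add: n_def)
    next
      case False
      then show ?thesis using FG[OF that False] G(4) by (simp add: h_def n_def)
    qed
  qed
qed

text \<open>The lift can be made to pass through whichever point of the fibre \<^const>\<open>inv_into\<close> selects,
  so the independence of the density of that point is not needed.\<close>

lemma orbifold_density_le:
  assumes d: "d > 0" "ball z d \<subseteq> U" "ramified_points U \<nu> \<inter> ball z d \<subseteq> {z}"
    and t0: "norm t0 < 1" "t0 \<noteq> 0" and w: "w = z + of_real d * t0 ^ \<nu> z"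
  shows "orbifold_density \<pi> w \<le> ennreal (disc_density t0 / (d * \<nu> z * norm t0 ^ (\<nu> z - 1)))"
proof -
  define n where "n = \<nu> z"
  have zU: "z \<in> U" using d by auto
  have n1: "n \<ge> 1" using nu_pos[OF zU] by (simp add: n_def)
  have "norm (t0 ^ n) < 1" using t0 n1 by (simp add: norm_power power_less_one_iff)
  then have wb: "w \<in> ball z d" using d(1) by (simp add: w n_def dist_norm norm_mult)
  have "w \<noteq> z" using d(1) t0 by (simp add: w)
  have wU: "w \<in> U" using wb d(2) by blast
  define x where "x = inv_into (ball 0 1) \<pi> w"
  have x: "x \<in> ball 0 1" "\<pi> x = w"
    unfolding x_def using wU surjective by (metis inv_into_into, metis f_inv_into_f)
  obtain F where F: "F holomorphic_on ball 0 1" "\<And>t. norm t < 1 \<Longrightarrow> norm (F t) < 1" "F t0 = x"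
    "\<And>t. norm t < 1 \<Longrightarrow> \<pi> (F t) = z + of_real d * t ^ n"
    using lift_power_disc[OF d x(1) t0] x(2) w unfolding n_def by metis
  have dF: "(F has_field_derivative deriv F t0) (at t0)"
    using holomorphic_derivI[OF F(1)] t0 by auto
  have dp: "(\<pi> has_field_derivative deriv \<pi> x) (at (F t0))"
    using holomorphic_derivI[OF holomorphic] x(1) F(3) by auto
  have "(\<pi> \<circ> F has_field_derivative deriv \<pi> x * deriv F t0) (at t0)"
    by (rule DERIV_chain[OF dp dF])
  moreover have "(\<pi> \<circ> F has_field_derivative of_real d * (of_nat n * t0 ^ (n - 1))) (at t0)"
  proof (rule has_field_derivative_transform_within_open)
    show "((\<lambda>t. z + of_real d * t ^ n) has_field_derivative of_real d * (of_nat n * t0 ^ (n - 1))) (at t0)"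
      by (auto intro!: derivative_eq_intros)
    show "z + of_real d * t ^ n = (\<pi> \<circ> F) t" if "t \<in> ball 0 1" for t
      using F(4) that by simp
  qed (use t0 in auto)
  ultimately have eq: "deriv \<pi> x * deriv F t0 = of_real d * (of_nat n * t0 ^ (n - 1))"
    by (rule DERIV_unique)
  then have eqn: "norm (deriv \<pi> x) * norm (deriv F t0) = d * n * norm t0 ^ (n - 1)"
    using d(1) by (metis (no_types, opaque_lifting) abs_of_pos mult.assoc norm_mult norm_of_nat norm_of_real norm_power)
  have SP: "disc_density x * norm (deriv F t0) \<le> disc_density t0"
    using Schwarz_Pick_deriv[OF F(1,2) t0(1)] F(3) by simp
  \<comment> \<open>Here \<open>t0 \<noteq> 0\<close> is decisive: the derivative of the composite
    is nonzero, hence so is \<open>deriv \<pi> x\<close>, and the density is a finite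
    quotient.\<close>
  have pos: "d * n * norm t0 ^ (n - 1) > 0" using d(1) n1 t0 by simp
  then have pp: "norm (deriv \<pi> x) > 0" "norm (deriv F t0) > 0"
    using eqn by (metis mult_eq_0_iff norm_ge_zero order_le_less order_less_irrefl)+
  have "disc_density x / norm (deriv \<pi> x) = disc_density x * norm (deriv F t0) / (norm (deriv \<pi> x) * norm (deriv F t0))"
    using pp by simp
  also have "\<dots> \<le> disc_density t0 / (d * n * norm t0 ^ (n - 1))"
    unfolding eqn using SP pos by (intro divide_right_mono) auto
  finally have le: "disc_density x / norm (deriv \<pi> x) \<le> disc_density t0 / (d * n * norm t0 ^ (n - 1))" .
  have "disc_density x \<ge> 0" using x(1) by (simp add: disc_density_def power_le_one_iff abs_square_le_1 less_imp_le)
  then have "orbifold_density \<pi> w = ennreal (disc_density x / norm (deriv \<pi> x))"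
    using pp by (simp add: orbifold_density_def x_def[symmetric] divide_ennreal)
  with le show ?thesis by (simp add: n_def ennreal_leI)
qed

end

section \<open>Lengths of Lipschitz curves\<close>

text \<open>\<open>L * t - F t\<close> is nondecreasing too. Its Stieltjes measure and that of
  \<open>F\<close> add up to \<open>L\<close> times Lebesgue measure, as comparison on half-open
  intervals shows; dropping one summand gives the bound.\<close>

lemma interval_measure_le_lborel:
  fixes F :: "real \<Rightarrow> real"
  assumes mono: "\<And>s t. s \<le> t \<Longrightarrow> F s \<le> F t" and lip: "\<And>s t. s \<le> t \<Longrightarrow> F t - F s \<le> L * (t - s)"
  shows "interval_measure F \<le> scale_measure (ennreal L) lborel"
proof -
  have "L \<ge> 0" using mono[of 0 1] lip[of 0 1] by simp
  define G where "G t = L * t - F t" for t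
  have monoG: "s \<le> t \<Longrightarrow> G s \<le> G t" for s t using lip[of s t] by (simp add: G_def algebra_simps)
  have "L-lipschitz_on UNIV F"
  proof (rule lipschitz_on_leI)
    show "dist (F s) (F t) \<le> L * dist s t" if "s \<le> t" for s t
      using mono[OF that] lip[OF that] that by (simp add: dist_real_def)
  qed (use \<open>L \<ge> 0\<close> in simp)
  then have contF: "continuous_on UNIV F" by (rule lipschitz_on_continuous_on)
  have contG: "continuous_on UNIV G" unfolding G_def by (intro continuous_intros contF)
  have rc: "continuous (at_right a) F" "continuous (at_right a) G" for a
    using contF contG by (auto simp: continuous_on_eq_continuous_at intro: continuous_at_imp_continuous_at_within)
  define S where "S = measure_of UNIV (sets borel)
    (\<lambda>A. emeasure (interval_measure F) A + emeasure (interval_measure G) A)"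
  have sets: "sets S = sets borel"
    unfolding S_def using sets.sigma_sets_eq[of "borel :: real measure"] by simp
  have emS: "emeasure S A = emeasure (interval_measure F) A + emeasure (interval_measure G) A"
    if "A \<in> sets borel" for A
  proof (rule emeasure_measure_of[OF S_def])
    show "countably_additive (sets S) (\<lambda>A. emeasure (interval_measure F) A + emeasure (interval_measure G) A)"
      unfolding countably_additive_def sets
      by (auto simp: suminf_add[symmetric] suminf_emeasure subset_eq)
  qed (use that sets in \<open>auto simp: positive_def\<close>)
  have "scale_measure (ennreal L) lborel = S"
  proof (rule measure_eqI_generator_eq[where E = "range (\<lambda>(a, b). {a<..b::real})" and \<Omega> = UNIV
        and A = "\<lambda>i. {- real i<..real i}"])
    show "Int_stable (range (\<lambda>(a, b). {a<..b::real}))"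
    proof -
      have "{a<..b} \<inter> {c<..d} = (\<lambda>(a, b). {a<..b}) (max a c, min b d)" for a b c d :: real by auto
      then have "{a<..b} \<inter> {c<..d} \<in> range (\<lambda>(a, b). {a<..b})" for a b c d :: real by blast
      then show ?thesis by (auto simp: Int_stable_def)
    qed
    show "sets (scale_measure (ennreal L) lborel) = sigma_sets UNIV (range (\<lambda>(a, b). {a<..b::real}))"
      by (simp add: borel_sigma_sets_Ioc)
    show "sets S = sigma_sets UNIV (range (\<lambda>(a, b). {a<..b::real}))"
      by (simp add: sets borel_sigma_sets_Ioc)
    show "(\<Union>i. {- real i<..real i}) = UNIV"
    proof (intro equalityI subset_UNIV subsetI)
      fix x :: real
      obtain i :: nat where "\<bar>x\<bar> < real i" using reals_Archimedean2 by blast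
      then have "x \<in> {- real i<..real i}" by auto
      then show "x \<in> (\<Union>i. {- real i<..real i})" by blast
    qed
    show "emeasure (scale_measure (ennreal L) lborel) {- real i<..real i} \<noteq> \<infinity>" for i
      by (simp add: ennreal_mult[symmetric] \<open>L \<ge> 0\<close>)
    fix X assume "X \<in> range (\<lambda>(a, b). {a<..b::real})"
    then obtain a b where X: "X = {a<..b}" by auto
    show "emeasure (scale_measure (ennreal L) lborel) X = emeasure S X"
    proof (cases "a \<le> b")
      case True
      have "emeasure S X = ennreal (F b - F a) + ennreal (G b - G a)"
        using True by (simp add: X emS emeasure_interval_measure_Ioc_eq mono monoG rc)
      also have "\<dots> = ennreal (L * (b - a))"
        using mono[OF True] monoG[OF True] by (simp add: ennreal_plus[symmetric] G_def algebra_simps del: ennreal_plus)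
      also have "\<dots> = emeasure (scale_measure (ennreal L) lborel) X"
        using True \<open>L \<ge> 0\<close> by (simp add: X ennreal_mult)
      finally show ?thesis by simp
    qed (simp add: X)
  qed auto
  then have "emeasure (interval_measure F) A \<le> emeasure (scale_measure (ennreal L) lborel) A" for A
  proof (cases "A \<in> sets borel")
    case True
    then show ?thesis using \<open>scale_measure (ennreal L) lborel = S\<close> emS by simp
  qed (simp add: emeasure_notin_sets)
  then show ?thesis by (simp add: le_measure)
qed

lemma nn_integral_scale_measure:
  assumes "f \<in> borel_measurable M"
  shows "nn_integral (scale_measure c M) f = c * nn_integral M f"
proof -
  have "scale_measure c M = density M (\<lambda>_. c)"
    by (rule measure_eqI) (simp_all add: emeasure_density nn_integral_cmult_indicator)
  then show ?thesis using assms by (simp add: nn_integral_density nn_integral_cmult)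
qed

section \<open>Arc length of a Lipschitz curve\<close>

lemma polygon_lengths_nonempty: "0 \<le> t \<Longrightarrow> polygon_lengths \<gamma> t \<noteq> {}"
  unfolding polygon_lengths_def by (auto intro!: exI[of _ 0] exI[of _ "\<lambda>_. 0"] simp: mono_def)

lemma polygon_lengths_mono: "t \<le> t' \<Longrightarrow> polygon_lengths \<gamma> t \<subseteq> polygon_lengths \<gamma> t'"
  unfolding polygon_lengths_def by fastforce

context
  fixes \<gamma> :: "real \<Rightarrow> complex" and L :: real
  assumes lip: "L-lipschitz_on {0..1} \<gamma>"
begin

text \<open>Clamping the vertices at \<open>t\<close> leaves a polygon over \<open>{0..t}\<close>.
  The part beyond \<open>t\<close> costs at most \<open>L\<close> times the parameter travelled
  there, which telescopes to at most \<open>t' - t\<close>.\<close>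

lemma polygon_sum_le:
  assumes "mono s" "range s \<subseteq> {0..t'}" "0 \<le> t" "t \<le> t'" "t' \<le> 1"
  shows "(\<Sum>i<n. dist (\<gamma> (s i)) (\<gamma> (s (Suc i)))) \<le>
    (\<Sum>i<n. dist (\<gamma> (min t (s i))) (\<gamma> (min t (s (Suc i))))) + L * (t' - t)"
proof -
  have s: "0 \<le> s i" "s i \<le> t'" "s i \<le> s (Suc i)" for i
    using assms(1,2) by (auto simp: image_subset_iff mono_iff_le_Suc)
  define e where "e i = s i - min t (s i)" for i
  have "dist (\<gamma> (s i)) (\<gamma> (s (Suc i))) \<le>
      dist (\<gamma> (min t (s i))) (\<gamma> (min t (s (Suc i)))) + L * (e (Suc i) - e i)" for i
  proof (cases "s (Suc i) \<le> t")
    case True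
    then show ?thesis using s[of i] by (simp add: e_def min_def)
  next
    case False
    \<comment> \<open>The edge is split at \<open>max t (s i)\<close>: this is \<open>t\<close> on
      the edge that crosses \<open>t\<close>, and \<open>s i\<close> on later edges, where the first
      piece vanishes.\<close>
    have "dist (\<gamma> (s i)) (\<gamma> (s (Suc i))) \<le>
        dist (\<gamma> (s i)) (\<gamma> (max t (s i))) + dist (\<gamma> (max t (s i))) (\<gamma> (s (Suc i)))"
      by (rule dist_triangle)
    also have "dist (\<gamma> (max t (s i))) (\<gamma> (s (Suc i))) \<le> L * dist (max t (s i)) (s (Suc i))"
      by (rule lipschitz_onD[OF lip]) (use s[of i] s[of "Suc i"] assms in auto)
    also have "dist (max t (s i)) (s (Suc i)) = e (Suc i) - e i"
      using False s[of i] by (auto simp: e_def dist_real_def min_def max_def)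
    also have "dist (\<gamma> (s i)) (\<gamma> (max t (s i))) = dist (\<gamma> (min t (s i))) (\<gamma> (min t (s (Suc i))))"
      using False by (auto simp: min_def max_def)
    finally show ?thesis by simp
  qed
  then have "(\<Sum>i<n. dist (\<gamma> (s i)) (\<gamma> (s (Suc i)))) \<le>
      (\<Sum>i<n. dist (\<gamma> (min t (s i))) (\<gamma> (min t (s (Suc i)))) + L * (e (Suc i) - e i))"
    by (intro sum_mono)
  also have "\<dots> = (\<Sum>i<n. dist (\<gamma> (min t (s i))) (\<gamma> (min t (s (Suc i))))) + L * (e n - e 0)"
    by (simp add: sum.distrib sum_distrib_left[symmetric] sum_lessThan_telescope)
  also have "L * (e n - e 0) \<le> L * (t' - t)"
    using s[of n] s[of 0] assms lipschitz_on_nonneg[OF lip] by (intro mult_left_mono) (auto simp: e_def min_def)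
  finally show ?thesis by simp
qed

lemma bdd_above_polygon_lengths:
  assumes "0 \<le> t" "t \<le> 1"
  shows "bdd_above (polygon_lengths \<gamma> t)"
proof (rule bdd_aboveI[of _ "L * t"])
  fix x assume "x \<in> polygon_lengths \<gamma> t"
  then obtain n s where x: "x = (\<Sum>i<n. dist (\<gamma> (s i)) (\<gamma> (s (Suc i))))" "mono s" "range s \<subseteq> {0..t}"
    by (auto simp: polygon_lengths_def)
  have "s i \<ge> 0" for i using x(3) by (auto simp: image_subset_iff)
  then have "min 0 (s i) = 0" for i by (simp add: min_def)
  then show "x \<le> L * t" using polygon_sum_le[OF x(2,3), of 0 n] assms x(1) by simp
qed

lemma lipschitz_rectifiable: "rectifiable \<gamma>"
  unfolding rectifiable_def path_def
  using bdd_above_polygon_lengths[of 1] lipschitz_on_continuous_on[OF lip] by simp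

lemma arc_length_mono:
  assumes "s \<le> t" shows "arc_length \<gamma> s \<le> arc_length \<gamma> t"
  unfolding arc_length_def
  by (intro cSup_subset_mono polygon_lengths_nonempty bdd_above_polygon_lengths polygon_lengths_mono)
    (use assms in auto)

lemma arc_length_lipschitz:
  assumes "s \<le> t" shows "arc_length \<gamma> t - arc_length \<gamma> s \<le> L * (t - s)"
proof -
  \<comment> \<open>\<open>arc_length\<close> is constant outside the unit interval; clamping can
    only shorten the parameter distance.\<close>
  define a b where "a = max 0 (min 1 s)" and "b = max 0 (min 1 t)"
  have ab: "0 \<le> a" "a \<le> b" "b \<le> 1" "b - a \<le> t - s" using assms by (auto simp: a_def b_def)
  have "Sup (polygon_lengths \<gamma> b) \<le> Sup (polygon_lengths \<gamma> a) + L * (b - a)"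
  proof (rule cSup_least)
    show "polygon_lengths \<gamma> b \<noteq> {}" using ab by (intro polygon_lengths_nonempty) auto
    fix x assume "x \<in> polygon_lengths \<gamma> b"
    then obtain n r where x: "x = (\<Sum>i<n. dist (\<gamma> (r i)) (\<gamma> (r (Suc i))))" "mono r" "range r \<subseteq> {0..b}"
      by (auto simp: polygon_lengths_def)
    have "(\<Sum>i<n. dist (\<gamma> (min a (r i))) (\<gamma> (min a (r (Suc i))))) \<in> polygon_lengths \<gamma> a"
      unfolding polygon_lengths_def
      using x(2,3) ab by (auto intro!: exI[of _ n] exI[of _ "\<lambda>i. min a (r i)"] simp: mono_def image_subset_iff min_le_iff_disj)
    then have "(\<Sum>i<n. dist (\<gamma> (min a (r i))) (\<gamma> (min a (r (Suc i))))) \<le> Sup (polygon_lengths \<gamma> a)"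
      using ab by (intro cSup_upper bdd_above_polygon_lengths) auto
    then show "x \<le> Sup (polygon_lengths \<gamma> a) + L * (b - a)"
      using polygon_sum_le[OF x(2,3) ab(1-3), of n] x(1) by simp
  qed
  also have "L * (b - a) \<le> L * (t - s)" using ab lipschitz_on_nonneg[OF lip] by (intro mult_left_mono)
  finally show ?thesis by (simp add: arc_length_def a_def b_def)
qed

lemma length_integral_le:
  assumes "g \<in> borel_measurable borel" "\<And>t. t \<in> {0..1} \<Longrightarrow> \<rho> (\<gamma> t) \<le> g t"
  shows "length_integral \<rho> \<gamma> \<le> ennreal L * (\<integral>\<^sup>+t\<in>{0..1}. g t \<partial>lborel)"
proof -
  have "length_integral \<rho> \<gamma> \<le> (\<integral>\<^sup>+t\<in>{0..1}. g t \<partial>interval_measure (arc_length \<gamma>))"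
    unfolding length_integral_def
    by (intro nn_integral_mono) (use assms in \<open>auto simp: indicator_def\<close>)
  also have "\<dots> \<le> (\<integral>\<^sup>+t\<in>{0..1}. g t \<partial>scale_measure (ennreal L) lborel)"
    by (intro nn_integral_mono_measure interval_measure_le_lborel arc_length_mono arc_length_lipschitz) auto
  also have "\<dots> = ennreal L * (\<integral>\<^sup>+t\<in>{0..1}. g t \<partial>lborel)"
    by (rule nn_integral_scale_measure) (use assms(1) in measurable)
  finally show ?thesis .
qed

end

section \<open>Curves with controlled density and their concatenation\<close>

text \<open>The density along the curve is not known to be measurable, hence the Borel majorant \<open>g\<close>.\<close>

definition lipschitz_joined :: "complex set \<Rightarrow> (complex \<Rightarrow> ennreal) \<Rightarrow> real \<Rightarrow> complex \<Rightarrow> complex \<Rightarrow> bool" where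
  "lipschitz_joined S \<rho> R p q \<longleftrightarrow>
     (\<exists>(\<gamma> :: real \<Rightarrow> complex) (g :: real \<Rightarrow> ennreal). R-lipschitz_on {0..1} \<gamma> \<and> \<gamma> ` {0..1} \<subseteq> S \<and> \<gamma> 0 = p \<and> \<gamma> 1 = q \<and>
     g \<in> borel_measurable borel \<and> (\<forall>t\<in>{0..1}. \<rho> (\<gamma> t) \<le> g t) \<and>
     (\<integral>\<^sup>+t\<in>{0..1}. g t \<partial>lborel) \<le> ennreal R)"

text \<open>The one number \<open>R\<close> bounds both the Lipschitz constant and the integral of
  the majorant, and the length integral is at most their product.\<close>

lemma lipschitz_joined_imp_orbifold_dist:
  assumes "lipschitz_joined S (orbifold_density \<pi>) R p q"
  shows "orbifold_dist S \<pi> p q \<le> ennreal (R * R)"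
proof -
  obtain \<gamma> :: "real \<Rightarrow> complex" and g :: "real \<Rightarrow> ennreal" where lip: "R-lipschitz_on {0..1} \<gamma>" and \<gamma>: "\<gamma> ` {0..1} \<subseteq> S" "\<gamma> 0 = p" "\<gamma> 1 = q"
    and g: "g \<in> borel_measurable borel" "\<forall>t\<in>{0..1}. orbifold_density \<pi> (\<gamma> t) \<le> g t"
    and int: "(\<integral>\<^sup>+t\<in>{0..1}. g t \<partial>lborel) \<le> ennreal R"
    using assms unfolding lipschitz_joined_def by blast
  have "orbifold_dist S \<pi> p q \<le> length_integral (orbifold_density \<pi>) \<gamma>"
    unfolding orbifold_dist_def
    by (rule INF_lower)
      (use lipschitz_rectifiable[OF lip] \<gamma> in \<open>auto simp: path_image_def pathstart_def pathfinish_def\<close>)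
  also have "\<dots> \<le> ennreal R * (\<integral>\<^sup>+t\<in>{0..1}. g t \<partial>lborel)"
    using g(2) by (intro length_integral_le[OF lip g(1)]) blast
  also have "\<dots> \<le> ennreal R * ennreal R" by (intro mult_left_mono int) simp
  also have "\<dots> = ennreal (R * R)"
    using lipschitz_on_nonneg[OF lip] by (simp add: ennreal_mult)
  finally show ?thesis .
qed

lemma lipschitz_joined_mono:
  assumes "lipschitz_joined S \<rho> R p q" "R \<le> R'"
  shows "lipschitz_joined S \<rho> R' p q"
proof -
  have "R-lipschitz_on {0..1} \<gamma> \<Longrightarrow> R'-lipschitz_on {0..1} \<gamma>" for \<gamma> :: "real \<Rightarrow> complex"
    using lipschitz_on_mono assms(2) by blast
  moreover have "x \<le> ennreal R \<Longrightarrow> x \<le> ennreal R'" for x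
    using assms(2) ennreal_leI order_trans by blast
  ultimately show ?thesis using assms(1) unfolding lipschitz_joined_def by blast
qed

text \<open>Running through both curves at double speed doubles the Lipschitz constants, whence the
  factor \<open>2\<close>. The majorants are reparametrised without rescaling, since the speed is
  already counted in the Lipschitz constant.\<close>

lemma lipschitz_joined_trans:
  assumes "lipschitz_joined S \<rho> R p q" "lipschitz_joined S \<rho> R' q r"
  shows "lipschitz_joined S \<rho> (2 * (R + R')) p r"
proof -
  obtain \<gamma> :: "real \<Rightarrow> complex" and g :: "real \<Rightarrow> ennreal" where lip: "R-lipschitz_on {0..1} \<gamma>" and \<gamma>: "\<gamma> ` {0..1} \<subseteq> S" "\<gamma> 0 = p" "\<gamma> 1 = q"
    and g: "g \<in> borel_measurable borel" "\<forall>t\<in>{0..1}. \<rho> (\<gamma> t) \<le> g t"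
    and int: "(\<integral>\<^sup>+t\<in>{0..1}. g t \<partial>lborel) \<le> ennreal R"
    using assms(1) unfolding lipschitz_joined_def by blast
  obtain \<gamma>' :: "real \<Rightarrow> complex" and g' :: "real \<Rightarrow> ennreal" where lip': "R'-lipschitz_on {0..1} \<gamma>'" and \<gamma>': "\<gamma>' ` {0..1} \<subseteq> S" "\<gamma>' 0 = q" "\<gamma>' 1 = r"
    and g': "g' \<in> borel_measurable borel" "\<forall>t\<in>{0..1}. \<rho> (\<gamma>' t) \<le> g' t"
    and int': "(\<integral>\<^sup>+t\<in>{0..1}. g' t \<partial>lborel) \<le> ennreal R'"
    using assms(2) unfolding lipschitz_joined_def by blast
  have R: "R \<ge> 0" "R' \<ge> 0" using lip lip' lipschitz_on_nonneg by blast+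
  note [measurable] = g(1) g'(1)
  define \<delta> where "\<delta> t = (if t \<le> 1/2 then \<gamma> (2 * t) else \<gamma>' (2 * t - 1))" for t
  define h where "h t = (if t \<le> 1/2 then g (2 * t) else g' (2 * t - 1))" for t
  show ?thesis
    unfolding lipschitz_joined_def
  proof (intro exI[of _ \<delta>] exI[of _ h] conjI ballI)
    have l1: "(2 * (R + R'))-lipschitz_on {0..1/2} (\<lambda>t. \<gamma> (2 * t))"
    proof (rule lipschitz_onI)
      fix x y :: real assume "x \<in> {0..1/2}" "y \<in> {0..1/2}"
      then have "dist (\<gamma> (2 * x)) (\<gamma> (2 * y)) \<le> R * dist (2 * x) (2 * y)"
        by (intro lipschitz_onD[OF lip]) auto
      also have "dist (2 * x) (2 * y) = 2 * dist x y" by (simp add: dist_real_def abs_if)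
      also have "R * (2 * dist x y) \<le> 2 * (R + R') * dist x y" using R by (simp add: algebra_simps)
      finally show "dist (\<gamma> (2 * x)) (\<gamma> (2 * y)) \<le> 2 * (R + R') * dist x y" .
    qed (use R in auto)
    have l2: "(2 * (R + R'))-lipschitz_on {1/2..1} (\<lambda>t. \<gamma>' (2 * t - 1))"
    proof (rule lipschitz_onI)
      fix x y :: real assume "x \<in> {1/2..1}" "y \<in> {1/2..1}"
      then have "dist (\<gamma>' (2 * x - 1)) (\<gamma>' (2 * y - 1)) \<le> R' * dist (2 * x - 1) (2 * y - 1)"
        by (intro lipschitz_onD[OF lip']) auto
      also have "dist (2 * x - 1) (2 * y - 1) = 2 * dist x y" by (simp add: dist_real_def abs_if)
      also have "R' * (2 * dist x y) \<le> 2 * (R + R') * dist x y" using R by (simp add: algebra_simps)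
      finally show "dist (\<gamma>' (2 * x - 1)) (\<gamma>' (2 * y - 1)) \<le> 2 * (R + R') * dist x y" .
    qed (use R in auto)
    show "(2 * (R + R'))-lipschitz_on {0..1} \<delta>"
      unfolding \<delta>_def using lipschitz_on_concat[OF l1 l2] \<gamma> \<gamma>' by simp
    show "\<delta> ` {0..1} \<subseteq> S" using \<gamma>(1) \<gamma>'(1) by (auto simp: \<delta>_def image_subset_iff)
    show "\<delta> 0 = p" "\<delta> 1 = r" using \<gamma> \<gamma>' by (auto simp: \<delta>_def)
    show "h \<in> borel_measurable borel" unfolding h_def by measurable
    show "\<rho> (\<delta> t) \<le> h t" if "t \<in> {0..1}" for t
      using that bspec[OF g(2), of "2 * t"] bspec[OF g'(2), of "2 * t - 1"] by (auto simp: \<delta>_def h_def)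
    have "(\<integral>\<^sup>+t\<in>{0..1}. h t \<partial>lborel) \<le>
        (\<integral>\<^sup>+t. g (0 + 2 * t) * indicator {0..1} (0 + 2 * t) + g' (-1 + 2 * t) * indicator {0..1} (-1 + 2 * t) \<partial>lborel)"
      by (intro nn_integral_mono) (auto simp: h_def indicator_def)
    also have "\<dots> = (\<integral>\<^sup>+t. g (0 + 2 * t) * indicator {0..1} (0 + 2 * t) \<partial>lborel) +
        (\<integral>\<^sup>+t. g' (-1 + 2 * t) * indicator {0..1} (-1 + 2 * t) \<partial>lborel)"
      by (rule nn_integral_add) measurable
    also have "\<dots> \<le> (\<integral>\<^sup>+t\<in>{0..1}. g t \<partial>lborel) + (\<integral>\<^sup>+t\<in>{0..1}. g' t \<partial>lborel)"
    proof (rule add_mono)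
      \<comment> \<open>The substitution halves each integral; this gain is given away.\<close>
      have le2: "x \<le> ennreal 2 * x" for x :: ennreal
        using mult_right_mono[of 1 "ennreal 2" x] by simp
      show "(\<integral>\<^sup>+t. g (0 + 2 * t) * indicator {0..1} (0 + 2 * t) \<partial>lborel) \<le> (\<integral>\<^sup>+t\<in>{0..1}. g t \<partial>lborel)"
        by (subst (2) nn_integral_real_affine[where c = 2 and t = 0]) (use le2 in auto)
      show "(\<integral>\<^sup>+t. g' (-1 + 2 * t) * indicator {0..1} (-1 + 2 * t) \<partial>lborel) \<le> (\<integral>\<^sup>+t\<in>{0..1}. g' t \<partial>lborel)"
        by (subst (2) nn_integral_real_affine[where c = 2 and t = "-1"]) (use le2 in auto)
    qed
    also have "\<dots> \<le> ennreal R + ennreal R'" by (intro add_mono int int')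
    also have "\<dots> \<le> ennreal (2 * (R + R'))"
      using R by (simp add: ennreal_plus[symmetric] ennreal_leI del: ennreal_plus)
    finally show "(\<integral>\<^sup>+t\<in>{0..1}. h t \<partial>lborel) \<le> ennreal (2 * (R + R'))" .
  qed
qed

section \<open>Integrating the density along segments\<close>

text \<open>The value at \<open>0\<close> is set by hand because \<open>0 powr a = 0\<close>,
  whereas the majorant must dominate the density also at ramified points, where the fibre derivative
  may vanish.\<close>

definition singular_kernel :: "real \<Rightarrow> real \<Rightarrow> ennreal" where
  "singular_kernel a u = (if u = 0 then \<infinity> else ennreal (\<bar>u\<bar> powr a))"

lemma borel_measurable_singular_kernel [measurable]: "singular_kernel a \<in> borel_measurable borel"
  unfolding singular_kernel_def[abs_def] by measurable

text \<open>The bound is uniform in \<open>\<tau>\<close>. Within distance \<open>1\<close> of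
  \<open>\<tau>\<close> each side contributes at most \<open>1 / (a + 1)\<close>, the integral of
  \<open>u powr a\<close> over the unit interval; farther away the kernel is at most
  \<open>1\<close>.\<close>

lemma nn_integral_singular_kernel:
  assumes a: "-1 < a" "a \<le> 0"
  shows "(\<integral>\<^sup>+t\<in>{0..1}. singular_kernel a (t - \<tau>) \<partial>lborel) \<le> ennreal (2 / (a + 1) + 1)"
proof -
  define f where "f u = ennreal (\<bar>u\<bar> powr a) * indicator {0..1} u" for u :: real
  have [measurable]: "f \<in> borel_measurable borel" unfolding f_def by measurable
  have "((\<lambda>x. x powr a) has_integral 1 / (a + 1)) {0..1}"
    using has_integral_powr_from_0[of a 1] a by simp
  then have "(\<integral>\<^sup>+u. ennreal (u powr a * indicator {0..1} u) \<partial>lborel) = ennreal (1 / (a + 1))"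
    using nn_integral_has_integral_lebesgue[of "{0..1}" "\<lambda>x. x powr a" "1 / (a + 1)"]
    by (simp add: mult.commute)
  moreover have "f u = ennreal (u powr a * indicator {0..1} u)" for u
    by (simp add: f_def indicator_def)
  ultimately have intf: "(\<integral>\<^sup>+u. f u \<partial>lborel) = ennreal (1 / (a + 1))" by simp
  have "AE t in lborel. t \<noteq> \<tau>" by (rule AE_lborel_singleton)
  moreover have "singular_kernel a (t - \<tau>) * indicator {0..1} t \<le>
      f (- \<tau> + 1 * t) + f (\<tau> + (-1) * t) + indicator {0..1} t" if "t \<noteq> \<tau>" for t
  proof (cases "\<bar>t - \<tau>\<bar> \<le> 1")
    case True
    then show ?thesis using that
      by (cases "t \<ge> \<tau>") (auto simp: singular_kernel_def f_def indicator_def abs_minus_commute add_increasing2 add_increasing)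
  next
    case False
    then have "\<bar>t - \<tau>\<bar> powr a \<le> \<bar>t - \<tau>\<bar> powr 0" using a by (intro powr_mono) auto
    then have "singular_kernel a (t - \<tau>) \<le> 1"
      using that by (simp add: singular_kernel_def)
    then show ?thesis by (auto simp: indicator_def add_increasing)
  qed
  ultimately have "(\<integral>\<^sup>+t\<in>{0..1}. singular_kernel a (t - \<tau>) \<partial>lborel) \<le>
     (\<integral>\<^sup>+t. f (- \<tau> + 1 * t) + f (\<tau> + (-1) * t) + indicator {0..1} t \<partial>lborel)"
    by (intro nn_integral_mono_AE) auto
  also have "\<dots> = (\<integral>\<^sup>+t. f (- \<tau> + 1 * t) \<partial>lborel) + (\<integral>\<^sup>+t. f (\<tau> + (-1) * t) \<partial>lborel) +
      (\<integral>\<^sup>+t. indicator {0..1::real} t \<partial>lborel)"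
    by (subst nn_integral_add, measurable, subst nn_integral_add, measurable)
  also have "(\<integral>\<^sup>+t. f (- \<tau> + 1 * t) \<partial>lborel) = ennreal (1 / (a + 1))"
    using nn_integral_real_affine[of f 1 "- \<tau>"] intf by simp
  also have "(\<integral>\<^sup>+t. f (\<tau> + (-1) * t) \<partial>lborel) = ennreal (1 / (a + 1))"
    using nn_integral_real_affine[of f "-1" \<tau>] intf by simp
  also have "(\<integral>\<^sup>+t. indicator {0..1::real} t \<partial>lborel) = ennreal 1" by simp
  also have "ennreal (1 / (a + 1)) + ennreal (1 / (a + 1)) + ennreal 1 = ennreal (2 / (a + 1) + 1)"
    using a by (simp add: ennreal_plus[symmetric] del: ennreal_plus ennreal_1)
  finally show ?thesis .
qed

section \<open>Pointwise bounds for the orbifold density\<close>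

text \<open>For large \<open>n\<close> the point \<open>t\<close> may be close to the unit circle.
  With \<open>u = |t|^2\<close>, Bernoulli gives \<open>1 - n (1 - u) \<le> u^n \<le> 1/4\<close>,
  so the growth is only linear in \<open>n\<close>; that factor later cancels against the
  \<open>n\<close> in the derivative of \<open>t^n\<close>.\<close>

lemma disc_density_le:
  assumes "norm t < 1" "norm t ^ n < 1 / 2"
  shows "disc_density t \<le> 8 * n / 3"
proof -
  define u where "u = (norm t)\<^sup>2"
  have u: "0 \<le> u" "u < 1" using assms(1) by (auto simp: u_def power_less_one_iff abs_square_less_1)
  have "u ^ n = (norm t ^ n)\<^sup>2" by (simp add: u_def power_mult[symmetric] mult.commute)
  also have "\<dots> \<le> (1 / 2)\<^sup>2" using assms(2) by (intro power_mono) auto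
  finally have "u ^ n \<le> 1 / 4" by (simp add: power2_eq_square)
  moreover have "1 + n * (u - 1) \<le> (1 + (u - 1)) ^ n" using u by (intro Bernoulli_inequality) auto
  ultimately have "3 / 4 \<le> n * (1 - u)" by (simp add: algebra_simps)
  then show ?thesis using u by (simp add: disc_density_def u_def[symmetric] field_simps)
qed

context disc_orbifold_covering
begin

text \<open>The lift lives on the disc of radius \<open>2 * \<eta>\<close> while \<open>w\<close> is
  within \<open>\<eta>\<close>, so \<open>|t|^n < 1/2\<close> and \<open>disc_density_le\<close>
  applies.\<close>

lemma density_le_near_ramified:
  assumes \<eta>: "\<eta> > 0" "ball z (2 * \<eta>) \<subseteq> U" "ramified_points U \<nu> \<inter> ball z (2 * \<eta>) \<subseteq> {z}"
    and w: "w \<noteq> z" "dist w z < \<eta>" and c: "\<nu> z \<le> c"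
  shows "orbifold_density \<pi> w \<le> ennreal (4 / (3 * \<eta>) * (dist w z / (2 * \<eta>)) powr (1 / c - 1))"
proof -
  define n where "n = \<nu> z"
  have "z \<in> ball z (2 * \<eta>)" using \<eta>(1) by simp
  then have "z \<in> U" using \<eta>(2) by blast
  then have n: "n \<ge> 1" "n \<le> c" using nu_pos c by (auto simp: n_def)
  define y where "y = (w - z) / of_real (2 * \<eta>)"
  define v where "v = dist w z / (2 * \<eta>)"
  have v: "norm y = v" "0 < v" "v < 1 / 2"
    using w \<eta>(1) by (simp_all add: y_def v_def dist_norm norm_divide norm_mult)
  have "y \<noteq> 0" using v by auto
  define t where "t = exp (Ln y / of_nat n)"
  have tn: "t ^ n = y" using n \<open>y \<noteq> 0\<close> by (simp add: t_def exp_of_nat_mult[symmetric])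
  have "t \<noteq> 0" by (simp add: t_def)
  have nt: "norm t ^ n = v" using tn v(1) by (metis norm_power)
  have "norm t < 1"
  proof (rule ccontr)
    assume "\<not> norm t < 1"
    then have "1 \<le> norm t ^ n" by (intro one_le_power) auto
    then show False using nt v by simp
  qed
  have wt: "w = z + of_real (2 * \<eta>) * t ^ \<nu> z"
    using \<eta>(1) by (simp add: n_def[symmetric] tn y_def)
  have "norm t ^ (n - 1) = v powr (1 - 1 / n)"
  proof -
    have "v powr (1 - 1 / n) = norm t powr (n * (1 - 1 / n))"
      using nt \<open>t \<noteq> 0\<close> by (simp add: powr_powr[symmetric] powr_realpow)
    also have "real n * (1 - 1 / n) = real (n - 1)" using n by (simp add: field_simps of_nat_diff)
    finally show ?thesis using \<open>t \<noteq> 0\<close> by (simp add: powr_realpow)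
  qed
  then have "1 / norm t ^ (n - 1) = v powr (1 / n - 1)"
    using powr_minus_divide[of v "1 - 1 / n"] by simp
  \<comment> \<open>Since \<open>v < 1\<close>, lowering the exponent from \<open>1/n - 1\<close> to
    \<open>1/c - 1\<close> increases the power, which removes the dependence on
    \<open>n\<close>.\<close>
  also have "\<dots> \<le> v powr (1 / c - 1)"
    using v n by (intro powr_mono') (auto simp: frac_le)
  finally have le: "1 / norm t ^ (n - 1) \<le> v powr (1 / c - 1)" .
  have "disc_density t / (2 * \<eta> * n * norm t ^ (n - 1)) \<le> (8 * n / 3) / (2 * \<eta> * n * norm t ^ (n - 1))"
    using disc_density_le[OF \<open>norm t < 1\<close>, of n] nt v \<eta>(1) by (intro divide_right_mono) auto
  also have "\<dots> = 4 / (3 * \<eta>) * (1 / norm t ^ (n - 1))" using n \<eta>(1) by (simp add: field_simps)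
  also have "\<dots> \<le> 4 / (3 * \<eta>) * v powr (1 / c - 1)"
    using le \<eta>(1) by (intro mult_left_mono) auto
  finally have "disc_density t / (2 * \<eta> * \<nu> z * norm t ^ (\<nu> z - 1)) \<le> 4 / (3 * \<eta>) * v powr (1 / c - 1)"
    by (simp add: n_def)
  then show ?thesis
    using orbifold_density_le[OF _ \<eta>(2,3) \<open>norm t < 1\<close> \<open>t \<noteq> 0\<close> wt] \<eta>(1) ennreal_leI order_trans
    unfolding v_def by fastforce
qed

lemma density_le_away_from_ramified:
  assumes \<eta>: "\<eta> > 0" "ball w \<eta> \<subseteq> U" "ramified_points U \<nu> \<inter> ball w \<eta> = {}"
  shows "orbifold_density \<pi> w \<le> ennreal (16 / (3 * \<eta>))"
proof -
  \<comment> \<open>The lifted bound excludes the centre \<open>t0 = 0\<close>, so the disc is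
    centred at distance \<open>\<eta> / 4\<close> from \<open>w\<close>. With radius
    \<open>\<eta> / 2\<close> it stays in \<open>ball w \<eta>\<close>, and \<open>w\<close>
    corresponds to \<open>t0 = -1/2\<close>.\<close>
  define z where "z = w + of_real (\<eta> / 4)"
  have dz: "dist w z = \<eta> / 4" using \<eta>(1) by (simp add: z_def dist_norm)
  have sub: "ball z (\<eta> / 2) \<subseteq> ball w \<eta>"
  proof
    fix u assume "u \<in> ball z (\<eta> / 2)"
    then show "u \<in> ball w \<eta>" using dz dist_triangle[of w u z] \<eta>(1) by (simp add: dist_commute)
  qed
  have "z \<in> ball z (\<eta> / 2)" using \<eta>(1) by simp
  then have "z \<in> U - ramified_points U \<nu>" using sub \<eta> by blast
  then have nz: "\<nu> z = 1" by (rule nu_unramified)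
  have "orbifold_density \<pi> w \<le> ennreal (disc_density (-1/2) / (\<eta> / 2 * \<nu> z * norm (-1/2 :: complex) ^ (\<nu> z - 1)))"
    by (rule orbifold_density_le) (use \<eta> sub nz in \<open>auto simp: z_def\<close>)
  also have "disc_density (-1/2) / (\<eta> / 2 * \<nu> z * norm (-1/2 :: complex) ^ (\<nu> z - 1)) = 16 / (3 * \<eta>)"
    using \<eta>(1) by (simp add: nz disc_density_def norm_divide power2_eq_square field_simps)
  finally show ?thesis .
qed

text \<open>Separation by \<open>2 * \<eta>\<close> isolates a ramified point close to
  \<open>w\<close>. Summing over all ramified points gives a single formula along a segment,
  whichever point happens to be close.\<close>

lemma density_le:
  assumes \<eta>: "\<eta> > 0" "ball w (3 * \<eta>) \<subseteq> U" and w: "w \<notin> ramified_points U \<nu>"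
    and sep: "\<And>z z'. z \<in> ramified_points U \<nu> \<Longrightarrow> z' \<in> ramified_points U \<nu> \<Longrightarrow> z \<noteq> z' \<Longrightarrow> 2 * \<eta> \<le> dist z z'"
    and c: "\<And>z. z \<in> ramified_points U \<nu> \<Longrightarrow> \<nu> z \<le> c"
  shows "orbifold_density \<pi> w \<le> ennreal (16 / (3 * \<eta>)) +
    (\<Sum>z\<in>ramified_points U \<nu>. ennreal (4 / (3 * \<eta>) * (dist w z / (2 * \<eta>)) powr (1 / c - 1)))"
proof (cases "\<exists>z\<in>ramified_points U \<nu>. dist w z < \<eta>")
  case True
  then obtain z where z: "z \<in> ramified_points U \<nu>" "dist w z < \<eta>" by blast
  have "ball z (2 * \<eta>) \<subseteq> ball w (3 * \<eta>)"
  proof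
    fix u assume "u \<in> ball z (2 * \<eta>)"
    then show "u \<in> ball w (3 * \<eta>)" using z(2) dist_triangle[of w u z] by simp
  qed
  moreover have "ramified_points U \<nu> \<inter> ball z (2 * \<eta>) \<subseteq> {z}"
    using sep[OF z(1)] by fastforce
  ultimately have "orbifold_density \<pi> w \<le> ennreal (4 / (3 * \<eta>) * (dist w z / (2 * \<eta>)) powr (1 / c - 1))"
    using z w \<eta> c by (intro density_le_near_ramified) auto
  also have "\<dots> \<le> (\<Sum>z\<in>ramified_points U \<nu>. ennreal (4 / (3 * \<eta>) * (dist w z / (2 * \<eta>)) powr (1 / c - 1)))"
    using finite_ramified z(1) by (intro member_le_sum) auto
  finally show ?thesis by (simp add: add_increasing)
next
  case False
  then have "orbifold_density \<pi> w \<le> ennreal (16 / (3 * \<eta>))"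
    using \<eta> by (intro density_le_away_from_ramified) (auto simp: subset_iff not_less)
  then show ?thesis by (simp add: add_increasing2)
qed

section \<open>Integration along a segment\<close>

lemma lipschitz_joined_segment:
  assumes \<eta>: "\<eta> > 0" and seg: "\<And>w. w \<in> closed_segment p q \<Longrightarrow> ball w (3 * \<eta>) \<subseteq> U"
    and pq: "\<eta> \<le> dist p q" "dist p q \<le> R" and c: "c \<ge> 1"
    and sep: "\<And>z z'. z \<in> ramified_points U \<nu> \<Longrightarrow> z' \<in> ramified_points U \<nu> \<Longrightarrow> z \<noteq> z' \<Longrightarrow> 2 * \<eta> \<le> dist z z'"
    and ram: "\<And>z. z \<in> ramified_points U \<nu> \<Longrightarrow> \<nu> z \<le> c"
    and R: "16 / (3 * \<eta>) + real (card (ramified_points U \<nu>)) * (8 / (3 * \<eta>) * (2 * real c + 1)) \<le> R"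
  shows "lipschitz_joined U (orbifold_density \<pi>) R p q"
proof -
  define a where "a = 1 / real c - 1"
  have a: "-1 < a" "a \<le> 0" using c by (auto simp: a_def)
  define \<gamma> where "\<gamma> = linepath p q"
  have \<gamma>: "\<gamma> t = p + of_real t * (q - p)" for t
    by (simp add: \<gamma>_def linepath_def scaleR_conv_of_real algebra_simps)
  \<comment> \<open>\<open>\<tau> z\<close> is the parameter of the foot of the perpendicular from
    \<open>z\<close> to the line through \<open>p\<close> and \<open>q\<close>. The distance from
    \<open>z\<close> is at least the distance travelled from the foot, and
    \<open>\<eta> \<le> dist p q\<close> bounds the speed from below.\<close>
  define \<tau> where "\<tau> z = - Re ((p - z) / (q - p))" for z
  have "q \<noteq> p" using pq(1) \<eta> by auto
  have dist_ge: "\<eta> * \<bar>t - \<tau> z\<bar> \<le> dist (\<gamma> t) z" for t z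
  proof -
    have "\<bar>t - \<tau> z\<bar> = \<bar>Re (of_real t + (p - z) / (q - p))\<bar>" by (simp add: \<tau>_def)
    also have "\<dots> \<le> norm (of_real t + (p - z) / (q - p))" by (rule abs_Re_le_cmod)
    finally have "\<eta> * \<bar>t - \<tau> z\<bar> \<le> dist p q * norm (of_real t + (p - z) / (q - p))"
      using pq(1) \<eta> by (intro mult_mono) auto
    also have "\<dots> = norm ((q - p) * (of_real t + (p - z) / (q - p)))"
      by (simp add: norm_mult dist_norm norm_minus_commute)
    also have "(q - p) * (of_real t + (p - z) / (q - p)) = \<gamma> t - z"
      using \<open>q \<noteq> p\<close> by (simp add: \<gamma> field_simps)
    finally show ?thesis by (simp add: dist_norm)
  qed
  define g where "g t = ennreal (16 / (3 * \<eta>)) +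
    (\<Sum>z\<in>ramified_points U \<nu>. ennreal (8 / (3 * \<eta>)) * singular_kernel a (t - \<tau> z))" for t
  have meas: "g \<in> borel_measurable borel" unfolding g_def by measurable
  have dom: "orbifold_density \<pi> (\<gamma> t) \<le> g t" if t: "t \<in> {0..1}" for t
  \<comment> \<open>At a foot parameter the majorant is infinite. At all other parameters
    \<open>dist_ge\<close> shows that the curve misses the ramified points.\<close>
  proof (cases "\<exists>z\<in>ramified_points U \<nu>. t = \<tau> z")
    case True
    then obtain z where z: "z \<in> ramified_points U \<nu>" "t = \<tau> z" by blast
    have "\<infinity> = ennreal (8 / (3 * \<eta>)) * singular_kernel a (t - \<tau> z)"
      using \<eta> z(2) by (simp add: singular_kernel_def ennreal_mult_eq_top_iff)
    also have "\<dots> \<le> (\<Sum>z\<in>ramified_points U \<nu>. ennreal (8 / (3 * \<eta>)) * singular_kernel a (t - \<tau> z))"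
      using finite_ramified z(1) by (intro member_le_sum) auto
    also have "\<dots> \<le> g t" by (simp add: g_def)
    finally have "g t = \<infinity>" by (simp add: top_unique)
    then show ?thesis by simp
  next
    case False
    have pos: "0 < \<eta> * \<bar>t - \<tau> z\<bar>" if "z \<in> ramified_points U \<nu>" for z
      using False that \<eta> by auto
    have "\<gamma> t \<notin> ramified_points U \<nu>" using pos[of "\<gamma> t"] dist_ge[of t "\<gamma> t"] by auto
    moreover have "\<gamma> t \<in> closed_segment p q"
      using t unfolding \<gamma>_def by (metis imageI linepath_image_01)
    ultimately have "orbifold_density \<pi> (\<gamma> t) \<le> ennreal (16 / (3 * \<eta>)) +
      (\<Sum>z\<in>ramified_points U \<nu>. ennreal (4 / (3 * \<eta>) * (dist (\<gamma> t) z / (2 * \<eta>)) powr (1 / c - 1)))"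
      using \<eta> seg sep ram by (intro density_le) auto
    also have "\<dots> \<le> g t"
      unfolding g_def
    proof (intro add_left_mono sum_mono)
      fix z assume z: "z \<in> ramified_points U \<nu>"
      define u where "u = \<bar>t - \<tau> z\<bar>"
      have u: "u > 0" using pos[OF z] \<eta> by (simp add: u_def zero_less_mult_iff)
      have "u / 2 \<le> dist (\<gamma> t) z / (2 * \<eta>)" using dist_ge[of t z] \<eta> by (simp add: u_def field_simps)
      then have "(dist (\<gamma> t) z / (2 * \<eta>)) powr a \<le> (u / 2) powr a"
        using u a by (intro powr_mono2') auto
      also have "\<dots> = u powr a * 2 powr (- a)" using u by (simp add: powr_divide powr_minus_divide)
      \<comment> \<open>As \<open>-a \<le> 1\<close>, the factor \<open>2 powr (- a)\<close> is at
        most \<open>2\<close>; this turns \<open>4 / (3 * \<eta>)\<close> into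
        \<open>8 / (3 * \<eta>)\<close>.\<close>
      also have "\<dots> \<le> u powr a * 2"
        using powr_mono[of "- a" 1 2] a by (intro mult_left_mono) auto
      finally have "4 / (3 * \<eta>) * (dist (\<gamma> t) z / (2 * \<eta>)) powr a \<le> 4 / (3 * \<eta>) * (u powr a * 2)"
        using \<eta> by (intro mult_left_mono) auto
      also have "\<dots> = 8 / (3 * \<eta>) * u powr a" by simp
      finally have "ennreal (4 / (3 * \<eta>) * (dist (\<gamma> t) z / (2 * \<eta>)) powr a) \<le> ennreal (8 / (3 * \<eta>) * u powr a)"
        by (rule ennreal_leI)
      also have "\<dots> = ennreal (8 / (3 * \<eta>)) * singular_kernel a (t - \<tau> z)"
        using u \<eta> by (simp add: singular_kernel_def u_def ennreal_mult[symmetric])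
      finally show "ennreal (4 / (3 * \<eta>) * (dist (\<gamma> t) z / (2 * \<eta>)) powr (1 / c - 1)) \<le>
        ennreal (8 / (3 * \<eta>)) * singular_kernel a (t - \<tau> z)" by (simp add: a_def)
    qed
    finally show ?thesis .
  qed
  have "(\<integral>\<^sup>+t\<in>{0..1}. g t \<partial>lborel) =
      (\<integral>\<^sup>+t. ennreal (16 / (3 * \<eta>)) * indicator {0..1} t +
        (\<Sum>z\<in>ramified_points U \<nu>. ennreal (8 / (3 * \<eta>)) * (singular_kernel a (t - \<tau> z) * indicator {0..1} t)) \<partial>lborel)"
    by (simp add: g_def distrib_right sum_distrib_right mult.assoc)
  also have "\<dots> = (\<integral>\<^sup>+t. ennreal (16 / (3 * \<eta>)) * indicator {0..1::real} t \<partial>lborel) +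
        (\<Sum>z\<in>ramified_points U \<nu>. ennreal (8 / (3 * \<eta>)) * (\<integral>\<^sup>+t\<in>{0..1}. singular_kernel a (t - \<tau> z) \<partial>lborel))"
    by (subst nn_integral_add, measurable, subst nn_integral_sum, measurable)
       (simp add: nn_integral_cmult)
  also have "\<dots> \<le> ennreal (16 / (3 * \<eta>)) +
        (\<Sum>z\<in>ramified_points U \<nu>. ennreal (8 / (3 * \<eta>)) * ennreal (2 / (a + 1) + 1))"
    by (intro add_mono sum_mono mult_left_mono nn_integral_singular_kernel a)
       (simp_all add: nn_integral_cmult_indicator)
  also have "2 / (a + 1) + 1 = 2 * real c + 1" by (simp add: a_def)
  also have "ennreal (16 / (3 * \<eta>)) + (\<Sum>z\<in>ramified_points U \<nu>. ennreal (8 / (3 * \<eta>)) * ennreal (2 * real c + 1)) =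
      ennreal (16 / (3 * \<eta>) + real (card (ramified_points U \<nu>)) * (8 / (3 * \<eta>) * (2 * real c + 1)))"
    using \<eta> by (simp add: ennreal_mult[symmetric] ennreal_of_nat_eq_real_of_nat ennreal_plus[symmetric] del: ennreal_plus)
  also have "\<dots> \<le> ennreal R" using R by (rule ennreal_leI)
  finally have int: "(\<integral>\<^sup>+t\<in>{0..1}. g t \<partial>lborel) \<le> ennreal R" .
  show ?thesis
    unfolding lipschitz_joined_def
  proof (intro exI[of _ \<gamma>] exI[of _ g] conjI ballI meas dom int)
    show "R-lipschitz_on {0..1} \<gamma>"
    proof (rule lipschitz_onI)
      show "dist (\<gamma> s) (\<gamma> t) \<le> R * dist s t" for s t
      proof -
        have "\<gamma> s - \<gamma> t = of_real (s - t) * (q - p)" by (simp add: \<gamma> algebra_simps)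
        then have "dist (\<gamma> s) (\<gamma> t) = dist p q * dist s t"
          by (simp add: dist_norm norm_mult norm_minus_commute mult.commute del: of_real_diff)
        then show ?thesis using pq(2) by (simp add: mult_right_mono)
      qed
      show "0 \<le> R" using pq \<eta> by linarith
    qed
    show "\<gamma> ` {0..1} \<subseteq> U"
    proof -
      have "w \<in> U" if "w \<in> closed_segment p q" for w using seg[OF that] \<eta> by auto
      then show ?thesis by (auto simp: \<gamma>_def linepath_image_01)
    qed
  qed (auto simp: \<gamma>)
qed

end

section \<open>From segments to compact sets\<close>

theorem theorem1p6:
  fixes U A :: "complex set" and r :: real and c M :: nat
  assumes "jordan_domain U"
    and "compact A" and "A \<subseteq> U"
    and "r > 0" and "c \<ge> 1" and "M \<ge> 1"
  shows "\<exists>R::real. R > 0 \<and>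
    (\<forall>\<nu> \<pi>. planar_orbifold U \<nu> \<longrightarrow>
       orbifold_universal_covering U \<nu> \<pi> \<longrightarrow>
       finite (ramified_points U \<nu>) \<longrightarrow>
       card (ramified_points U \<nu>) \<le> M \<longrightarrow>
       (\<forall>z\<in>ramified_points U \<nu>. \<nu> z \<le> c) \<longrightarrow>
       (\<forall>z\<in>ramified_points U \<nu>. \<forall>w\<in>ramified_points U \<nu>. z \<noteq> w \<longrightarrow> dist z w \<ge> r) \<longrightarrow>
       (\<forall>p\<in>A. \<forall>q\<in>A. orbifold_dist U \<pi> p q < ennreal R))"
proof -
  define Q where "Q \<nu> \<pi> \<longleftrightarrow> planar_orbifold U \<nu> \<and> orbifold_universal_covering U \<nu> \<pi> \<and>
       finite (ramified_points U \<nu>) \<and> card (ramified_points U \<nu>) \<le> M \<and>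
       (\<forall>z\<in>ramified_points U \<nu>. \<nu> z \<le> c) \<and>
       (\<forall>z\<in>ramified_points U \<nu>. \<forall>w\<in>ramified_points U \<nu>. z \<noteq> w \<longrightarrow> dist z w \<ge> r)" for \<nu> \<pi>
  \<comment> \<open>The quantifier over all admissible orbifolds sits inside \<open>J\<close>, after
    \<open>R\<close>, so every constant obtained by gluing is uniform over them.\<close>
  define J where "J R p q \<longleftrightarrow> (\<forall>\<nu> \<pi>. Q \<nu> \<pi> \<longrightarrow> lipschitz_joined U (orbifold_density \<pi>) R p q)" for R p q
  have Jtrans: "J (2 * (R + R')) p s" if "J R p q" "J R' q s" for R R' p q s
    using that lipschitz_joined_trans unfolding J_def by blast
  have Jmono: "J R' p q" if "J R p q" "R \<le> R'" for R R' p q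
    using that lipschitz_joined_mono unfolding J_def by blast
  have openU: "open U" and connU: "connected U"
    using assms(1) simply_connected_imp_connected by (auto simp: jordan_domain_def)

  \<comment> \<open>A segment in \<open>cball a (2 * \<eta>)\<close> keeps its
    \<open>3 * \<eta>\<close>-neighbourhood within \<open>5 * \<eta>\<close> of \<open>a\<close>. In
    \<open>R\<close> the summand \<open>4 * \<eta>\<close> bounds its length and the rest bounds the
    integral, with \<open>M\<close> in place of the number of ramified points.\<close>
  have seg: "J R p q" if \<eta>: "\<eta> > 0" "2 * \<eta> \<le> r" "ball a (6 * \<eta>) \<subseteq> U"
    and p: "p \<in> cball a (2 * \<eta>)" and q: "q \<in> cball a (2 * \<eta>)" and pq: "\<eta> \<le> dist p q"
    and R: "R = 4 * \<eta> + (16 / (3 * \<eta>) + real M * (8 / (3 * \<eta>) * (2 * real c + 1)))" for \<eta> a p q R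
    unfolding J_def
  proof (intro allI impI)
    fix \<nu> \<pi> assume Q: "Q \<nu> \<pi>"
    then interpret disc_orbifold_covering U \<nu> \<pi> by unfold_locales (auto simp: Q_def)
    show "lipschitz_joined U (orbifold_density \<pi>) R p q"
    proof (rule lipschitz_joined_segment[OF \<eta>(1) _ pq _ assms(5)])
      show "ball w (3 * \<eta>) \<subseteq> U" if "w \<in> closed_segment p q" for w
      proof -
        have "closed_segment p q \<subseteq> cball a (2 * \<eta>)" using p q by (intro closed_segment_subset) auto
        then have w: "dist a w \<le> 2 * \<eta>" using that by auto
        have "ball w (3 * \<eta>) \<subseteq> ball a (6 * \<eta>)"
        proof
          fix u assume "u \<in> ball w (3 * \<eta>)"
          then show "u \<in> ball a (6 * \<eta>)" using w dist_triangle[of a u w] \<eta>(1) by simp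
        qed
        then show ?thesis using \<eta>(3) by blast
      qed
      have pos: "16 / (3 * \<eta>) + real M * (8 / (3 * \<eta>) * (2 * real c + 1)) \<ge> 0" using \<eta>(1) by simp
      have "dist p q \<le> dist p a + dist a q" by (rule dist_triangle)
      then have "dist p q \<le> 4 * \<eta>" using p q by (simp add: dist_commute)
      then show "dist p q \<le> R" using pos unfolding R by linarith
      have "real (card (ramified_points U \<nu>)) * (8 / (3 * \<eta>) * (2 * real c + 1)) \<le> real M * (8 / (3 * \<eta>) * (2 * real c + 1))"
        using Q \<eta>(1) by (intro mult_right_mono) (auto simp: Q_def)
      then show "16 / (3 * \<eta>) + real (card (ramified_points U \<nu>)) * (8 / (3 * \<eta>) * (2 * real c + 1)) \<le> R"
        using \<eta>(1) unfolding R by linarith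
      show "2 * \<eta> \<le> dist z z'"
        if "z \<in> ramified_points U \<nu>" "z' \<in> ramified_points U \<nu>" "z \<noteq> z'" for z z'
        using Q that \<eta>(2) unfolding Q_def by (meson order_trans)
      show "\<nu> z \<le> c" if "z \<in> ramified_points U \<nu>" for z using Q that by (simp add: Q_def)
    qed
  qed

  \<comment> \<open>The bound for a segment degenerates as its length tends to \<open>0\<close>, so nearby points are joined
    through a third one at a definite distance from both.\<close>
  have loc: "\<exists>e>0. ball a e \<subseteq> U \<and> (\<exists>R. \<forall>p\<in>ball a e. \<forall>q\<in>ball a e. J R p q)" if aU: "a \<in> U" for a
  proof -
    obtain e where e: "e > 0" "ball a e \<subseteq> U" using openU aU openE by blast
    define \<eta> where "\<eta> = min (e / 6) (r / 2)"
    have \<eta>: "\<eta> > 0" "2 * \<eta> \<le> r" "6 * \<eta> \<le> e" using e assms(4) by (auto simp: \<eta>_def)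
    have sub: "ball a (6 * \<eta>) \<subseteq> U" using e(2) \<eta>(3) by (meson subset_ball subset_trans)
    \<comment> \<open>\<open>m\<close> is at distance \<open>2 * \<eta>\<close> from
      \<open>a\<close>, hence at least \<open>\<eta>\<close> from every point of
      \<open>ball a \<eta>\<close>.\<close>
    define m where "m = a + of_real (2 * \<eta>)"
    define R where "R = 4 * \<eta> + (16 / (3 * \<eta>) + real M * (8 / (3 * \<eta>) * (2 * real c + 1)))"
    have dm: "dist a m = 2 * \<eta>" using \<eta>(1) by (simp add: m_def dist_norm norm_mult)
    have "J (2 * (R + R)) p q" if pq: "p \<in> ball a \<eta>" "q \<in> ball a \<eta>" for p q
    proof (rule Jtrans[of R p m R q])
      have "\<eta> \<le> dist p m" "\<eta> \<le> dist m q"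
        using pq dm dist_triangle[of a m p] dist_triangle[of a m q] by (auto simp: dist_commute)
      then show "J R p m" "J R m q"
        using pq dm \<eta>(1) by (auto intro!: seg[OF \<eta>(1,2) sub _ _ _ R_def])
    qed
    moreover have "ball a \<eta> \<subseteq> U" using subset_ball[of \<eta> "6 * \<eta>" a] sub \<eta>(1) by auto
    ultimately show ?thesis using \<eta>(1) by blast
  qed
  \<comment> \<open>Being joined with some constant is transitive and holds locally, so it holds
    throughout the connected set \<open>U\<close>; the constant still depends on the pair.\<close>
  have joined: "\<exists>R. J R p q" if "p \<in> U" "q \<in> U" for p q
  proof (rule connected_equivalence_relation_gen[OF connU that, of "\<lambda>_. True" "\<lambda>p q. \<exists>R. J R p q"])
    show "\<exists>R. J R x z" if "\<exists>R. J R x y" "\<exists>R. J R y z" for x y z using that Jtrans by blast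
    fix a assume "a \<in> U"
    then obtain e R where e: "e > 0" "ball a e \<subseteq> U" "\<forall>p\<in>ball a e. \<forall>q\<in>ball a e. J R p q"
      using loc by blast
    then show "\<exists>T. openin (top_of_set U) T \<and> a \<in> T \<and> (\<forall>x\<in>T. \<forall>y\<in>T. True \<and> True \<longrightarrow> (\<exists>R. J R x y))"
      by (intro exI[of _ "ball a e"]) (auto intro: open_subset)
  qed auto
  have "\<exists>R. \<forall>p\<in>A. \<forall>q\<in>A. J R p q"
  proof (cases "A = {}")
    case False
    then obtain b where b: "b \<in> A" by blast
    \<comment> \<open>Both directions to the base point \<open>b\<close> are recorded, so that
      \<open>p\<close> and \<open>q\<close> can be joined through \<open>b\<close> by transitivity
      alone. Compactness then leaves finitely many constants.\<close>
    have "\<exists>e R. e > 0 \<and> (\<forall>p\<in>ball a e. J R p b \<and> J R b p)" if aA: "a \<in> A" for a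
    proof -
      have aU: "a \<in> U" "b \<in> U" using aA b assms(3) by auto
      obtain e R where e: "e > 0" "\<forall>p\<in>ball a e. \<forall>q\<in>ball a e. J R p q" using loc aU by blast
      obtain R1 R2 where R12: "J R1 a b" "J R2 b a" using joined aU by blast
      have "J (2 * (R + R1)) p b" "J (2 * (R2 + R)) b p" if "p \<in> ball a e" for p
      proof -
        have "J R p a" "J R a p" using e that by simp_all
        then show "J (2 * (R + R1)) p b" "J (2 * (R2 + R)) b p" using R12 Jtrans by blast+
      qed
      then show ?thesis using e(1) Jmono
        by (intro exI[of _ e] exI[of _ "max (2 * (R + R1)) (2 * (R2 + R))"]) (meson max.cobounded1 max.cobounded2)
    qed
    then obtain e R where eR: "\<And>a. a \<in> A \<Longrightarrow> e a > 0"
      "\<And>a p. a \<in> A \<Longrightarrow> p \<in> ball a (e a) \<Longrightarrow> J (R a) p b \<and> J (R a) b p" by metis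
    obtain C where C: "C \<subseteq> A" "finite C" "A \<subseteq> (\<Union>a\<in>C. ball a (e a))"
      using compactE_image[OF assms(2), of A "\<lambda>a. ball a (e a)"] eR(1) by force
    define B where "B = Max (insert 0 (R ` C))"
    have JB: "J B p b" "J B b p" if "p \<in> A" for p
    proof -
      obtain a where a: "a \<in> C" "p \<in> ball a (e a)" using C(3) \<open>p \<in> A\<close> by blast
      have "R a \<le> B" unfolding B_def using C(2) a(1) by (intro Max_ge) auto
      then show "J B p b" "J B b p" using eR(2)[of a p] a C(1) Jmono by blast+
    qed
    have "J (2 * (B + B)) p q" if "p \<in> A" "q \<in> A" for p q
      using Jtrans JB that by blast
    then show ?thesis by blast
  qed auto
  then obtain R where R: "\<And>p q. p \<in> A \<Longrightarrow> q \<in> A \<Longrightarrow> J R p q" by blast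
  show ?thesis
  \<comment> \<open>The added \<open>1\<close> makes the inequality strict and the constant
    positive.\<close>
  proof (intro exI[of _ "R * R + 1"] conjI allI impI ballI)
    show "0 < R * R + 1" using zero_le_square[of R] by linarith
    fix \<nu> \<pi> p q
    assume "planar_orbifold U \<nu>" "orbifold_universal_covering U \<nu> \<pi>" "finite (ramified_points U \<nu>)"
      "card (ramified_points U \<nu>) \<le> M" "\<forall>z\<in>ramified_points U \<nu>. \<nu> z \<le> c"
      "\<forall>z\<in>ramified_points U \<nu>. \<forall>w\<in>ramified_points U \<nu>. z \<noteq> w \<longrightarrow> dist z w \<ge> r"
      and pq: "p \<in> A" "q \<in> A"
    then have "Q \<nu> \<pi>" by (simp add: Q_def)
    then have "lipschitz_joined U (orbifold_density \<pi>) R p q" using R[OF pq] by (simp add: J_def)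
    then have "orbifold_dist U \<pi> p q \<le> ennreal (R * R)" by (rule lipschitz_joined_imp_orbifold_dist)
    also have "\<dots> < ennreal (R * R + 1)" by (intro ennreal_lessI) (auto intro: add_nonneg_pos)
    finally show "orbifold_dist U \<pi> p q < ennreal (R * R + 1)" .
  qed
qed

end
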